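(* Consider the AWGN red alert problem with noise variance $N>0$, average power constraint $P_{\text{avg}}>0$ and red alert power constraint $P_{\text{alert}}\ge P_{\text{avg}}$, and let $C=\frac12\log\left(1+\frac{P_{\text{avg}}}{N}\right)$. For every rate $0\le R<C$ (in nats), the optimal red alert exponent (the supremum of all achievable red alert exponents at rate $R$) equals $$E(R)=\frac{P_{\text{alert}}+P_{\text{avg}}+2\sqrt{P_{\text{alert}}\big(P_{\text{avg}}+N(1-e^{2R})\big)}}{2N}-R.$$
   Context: Setting (AWGN red alert problem). Messages are $w\in\{0,1,\dots,M\}$; $w=0$ is the red alert message (chosen with positive probability), and the others are equally likely. An encoder maps each $w$ to a codeword $\mathbf{x}(w)\in\mathbb{R}^n$ subject to the average block power constraint $\frac1M\sum_{w=1}^M\|\mathbf{x}(w)\|^2\le nP_{\text{avg}}$ and the red alert power constraint $\|\mathbf{x}(0)\|^2\le nP_{\text{alert}}$. The rate is $R=\frac1n\log M$ nats ($\log$ is natural). The channel outputs $\mathbf{y}=\mathbf{x}(w)+\mathbf{z}$ with $\mathbf{z}\sim\mathcal{N}(\mathbf{0},N\mathbf{I}_n)$ independent of $w$. A decoder is any map $\mathcal{D}:\mathbb{R}^n\to\{0,\dots,M\}$ producing $\hat w$. Define $p_{\text{MD}}=\mathbb{P}(\hat w\ne w\mid w=0)$, $p_{\text{FA}}=\mathbb{P}(\hat w=0\mid w\ne0)$, and $p_{\text{MSG}}=\frac1M\sum_{w=1}^M\mathbb{P}(\hat w\ne w\mid w\neq 0,\hat w\ne 0)$. A red alert exponent $E$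 is achievable at rate $R$ if for every $\epsilon>0$ and all sufficiently large $n$ there is an encoder of rate $R$ (with $M=e^{nR}$, rounded to an integer) and a decoder with $-\frac1n\log p_{\text{MD}}>E-\epsilon$, $p_{\text{FA}}<\epsilon$, and $p_{\text{MSG}}<\epsilon$. *)

theory Defs
  imports "HOL-Probability.Probability"
begin

text \<open>AWGN red alert problem. Block length n; codewords are vectors in R^n represented
  as functions nat => real restricted to coordinates i < n. Messages are 0..M,
  message 0 is the red alert message.\<close>

definition noise_measure :: "real \<Rightarrow> nat \<Rightarrow> (nat \<Rightarrow> real) measure" where
  "noise_measure N n = PiM {..<n} (\<lambda>_. density lborel (normal_density 0 (sqrt N)))"

definition out_prob ::
  "real \<Rightarrow> nat \<Rightarrow> (nat \<Rightarrow> nat \<Rightarrow> real) \<Rightarrow> ((nat \<Rightarrow> real) \<Rightarrow> nat) \<Rightarrow> nat \<Rightarrow> (nat \<Rightarrow> bool) \<Rightarrow> real"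
  where
  "out_prob N n x D w S =
     measure (noise_measure N n)
       {z \<in> space (noise_measure N n). S (D (\<lambda>i\<in>{..<n}. x w i + z i))}"

definition p_MD where
  "p_MD N n x D = out_prob N n x D 0 (\<lambda>v. v \<noteq> 0)"

definition p_FA where
  "p_FA N n M x D = (1 / real M) * (\<Sum>w\<in>{1..M}. out_prob N n x D w (\<lambda>v. v = 0))"

definition p_MSG where
  "p_MSG N n M x D = (1 / real M) *
     (\<Sum>w\<in>{1..M}. out_prob N n x D w (\<lambda>v. v \<noteq> w \<and> v \<noteq> 0)
                   / out_prob N n x D w (\<lambda>v. v \<noteq> 0))"

definition num_msgs :: "real \<Rightarrow> nat \<Rightarrow> nat" where
  "num_msgs R n = nat (round (exp (real n * R)))"

definition valid_code ::
  "real \<Rightarrow> real \<Rightarrow> nat \<Rightarrow> nat \<Rightarrow> (nat \<Rightarrow> nat \<Rightarrow> real) \<Rightarrow> ((nat \<Rightarrow> real) \<Rightarrow> nat) \<Rightarrow> bool"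
  where
  "valid_code Pavg Palert n M x D \<longleftrightarrow>
     (1 / real M) * (\<Sum>w\<in>{1..M}. \<Sum>i<n. (x w i)\<^sup>2) \<le> real n * Pavg \<and>
     (\<Sum>i<n. (x 0 i)\<^sup>2) \<le> real n * Palert \<and>
     D \<in> PiM {..<n} (\<lambda>_. borel) \<rightarrow>\<^sub>M count_space UNIV \<and>
     (\<forall>y. D y \<le> M)"

definition achievable_exponent :: "real \<Rightarrow> real \<Rightarrow> real \<Rightarrow> real \<Rightarrow> real \<Rightarrow> bool" where
  "achievable_exponent N Pavg Palert R E \<longleftrightarrow>
     (\<forall>\<epsilon>>0. \<exists>n0. \<forall>n\<ge>n0. \<exists>x D.
        valid_code Pavg Palert n (num_msgs R n) x D \<and>
        p_MD N n x D < exp (- real n * (E - \<epsilon>)) \<and>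
        p_FA N n (num_msgs R n) x D < \<epsilon> \<and>
        p_MSG N n (num_msgs R n) x D < \<epsilon>)"

definition optimal_exponent :: "real \<Rightarrow> real \<Rightarrow> real \<Rightarrow> real \<Rightarrow> ereal" where
  "optimal_exponent N Pavg Palert R = Sup {ereal E | E. achievable_exponent N Pavg Palert R E}"

end

theory Submission
  imports Defs
begin

text \<open>
  Let \<open>Pm = N (exp (2 R) - 1)\<close> be the power needed to communicate at rate \<open>R\<close>, and \<open>Pb = Pavg - Pm\<close>.

  Achievability: the codewords are \<open>sqrt Pb + c\<close> (coordinatewise), with \<open>c\<close> from a code of power slightly above
  \<open>Pm\<close> whose words are nearly orthogonal to the all-ones vector, and the red alert codeword is the
  constant \<open>- sqrt Palert\<close>. Each decoding set is shrunk to outputs on which the noise is typical; a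
  change of measure then bounds its probability under the red alert by \<open>exp (- d\<^sup>2 / (2 N))\<close> up to
  \<open>exp (o(n))\<close>, where \<open>d\<close> is the distance between the two codewords and
  \<open>d\<^sup>2 \<approx> n (Pm + (sqrt Palert + sqrt Pb)\<^sup>2)\<close>. The union bound over \<open>exp (n R)\<close> messages gives the exponent.

  Converse: codewords at squared distance exceeding \<open>n (Pm + (sqrt Palert + sqrt Pb)\<^sup>2 + \<delta>)\<close> from the red
  alert codeword lie in a ball of squared radius below \<open>n Pm\<close>, so by the strong converse to the channel
  coding theorem there are exponentially fewer than \<open>exp (n R)\<close> of them. A positive fraction of the
  disjoint decoding sets therefore belongs to closer codewords, and the reverse change of measure adds up
  their probabilities under the red alert.
\<close>

subsection \<open>Product Gaussian measures\<close>

text \<open>Independent centred summands are uncorrelated, so only the diagonal terms of the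
  expanded square survive. Chebyshev's inequality for linear and for quadratic statistics of the
  noise both rest on this.\<close>

lemma PiM_second_moment:
  fixes g :: "'i \<Rightarrow> 'a \<Rightarrow> real"
  assumes I: "finite I" and ps: "\<And>i. prob_space (M i)"
    and meas[measurable]: "\<And>i. i \<in> I \<Longrightarrow> g i \<in> borel_measurable (M i)"
    and sq: "\<And>i. i \<in> I \<Longrightarrow> integrable (M i) (\<lambda>x. (g i x)\<^sup>2)"
    and mean0: "\<And>i. i \<in> I \<Longrightarrow> (\<integral>x. g i x \<partial>M i) = 0"
  shows "integrable (PiM I M) (\<lambda>y. (\<Sum>i\<in>I. g i (y i))\<^sup>2)"
    and "(\<integral>y. (\<Sum>i\<in>I. g i (y i))\<^sup>2 \<partial>PiM I M) = (\<Sum>i\<in>I. \<integral>x. (g i x)\<^sup>2 \<partial>M i)"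
proof -
  interpret product_prob_space M I
    by (rule product_prob_spaceI[OF ps])
  have int: "integrable (M i) (g i)" if "i \<in> I" for i
    using finite_measure.square_integrable_imp_integrable[OF prob_space.finite_measure[OF ps]]
      meas[OF that] sq[OF that] by blast
  have cross: "integrable (PiM I M) (\<lambda>y. g i (y i) * g j (y j)) \<and>
      (\<integral>y. g i (y i) * g j (y j) \<partial>PiM I M) = (if i = j then (\<integral>x. (g i x)\<^sup>2 \<partial>M i) else 0)"
    if ij: "i \<in> I" "j \<in> I" for i j
  proof -
    \<comment> \<open>The product of two coordinates is written as a product over all of
      \<open>I\<close>, so that Fubini for finite products applies; for \<open>i = j\<close> the
      same formula yields the square.\<close>
    define f where "f k x = (if k = i then g k x else 1) * (if k = j then g k x else 1)" for k x
    have eq: "(\<Prod>k\<in>I. f k (y k)) = g i (y i) * g j (y j)" for y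
      unfolding f_def prod.distrib using I ij by (simp add: prod.delta')
    have intf: "integrable (M k) (f k)" if "k \<in> I" for k
      using int[OF that] sq[OF that] finite_measure.integrable_const[OF prob_space.finite_measure[OF ps]]
      by (cases "k = i"; cases "k = j") (auto simp: f_def[abs_def] power2_eq_square)
    have 1: "integrable (PiM I M) (\<lambda>y. g i (y i) * g j (y j))"
      using product_integrable_prod[OF I intf] unfolding eq .
    have 2: "(\<integral>y. g i (y i) * g j (y j) \<partial>PiM I M) = (\<Prod>k\<in>I. integral\<^sup>L (M k) (f k))"
      using product_integral_prod[OF I intf] unfolding eq .
    have "(\<Prod>k\<in>I. integral\<^sup>L (M k) (f k)) = (if i = j then (\<integral>x. (g i x)\<^sup>2 \<partial>M i) else 0)"
    proof (cases "i = j")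
      case True
      have "(\<Prod>k\<in>I. integral\<^sup>L (M k) (f k)) = (\<Prod>k\<in>I. if k = i then (\<integral>x. (g k x)\<^sup>2 \<partial>M k) else 1)"
        by (intro prod.cong refl) (auto simp: f_def[abs_def] True power2_eq_square
            prob_space.prob_space[OF ps])
      then show ?thesis using I ij True by (simp add: prod.delta')
    next
      case False
      have "integral\<^sup>L (M i) (f i) = 0"
        using False mean0[OF ij(1)] by (simp add: f_def[abs_def])
      then show ?thesis using False I ij(1) by (auto intro!: prod_zero)
    qed
    with 1 2 show ?thesis by simp
  qed
  have ex: "(\<Sum>i\<in>I. g i (y i))\<^sup>2 = (\<Sum>i\<in>I. \<Sum>j\<in>I. g i (y i) * g j (y j))" for y
    by (simp add: power2_eq_square sum_product)
  show "integrable (PiM I M) (\<lambda>y. (\<Sum>i\<in>I. g i (y i))\<^sup>2)"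
    unfolding ex using cross by (intro Bochner_Integration.integrable_sum) auto
  show "(\<integral>y. (\<Sum>i\<in>I. g i (y i))\<^sup>2 \<partial>PiM I M) = (\<Sum>i\<in>I. \<integral>x. (g i x)\<^sup>2 \<partial>M i)"
    unfolding ex using cross I by (simp add: Bochner_Integration.integral_sum Bochner_Integration.integrable_sum)
qed

text \<open>The law of the channel output when \<open>v\<close> is sent, for noise of standard
  deviation \<open>s\<close>. With \<open>v\<close> zero it serves both as the noise law and as the
  law of a random codeword.\<close>

definition gauss :: "nat \<Rightarrow> (nat \<Rightarrow> real) \<Rightarrow> real \<Rightarrow> (nat \<Rightarrow> real) measure" where
  "gauss n v s = PiM {..<n} (\<lambda>i. density lborel (normal_density (v i) s))"

lemma sets_gauss [measurable_cong]: "sets (gauss n v s) = sets (PiM {..<n} (\<lambda>_. borel))"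
  unfolding gauss_def by (intro sets_PiM_cong) auto

lemma space_gauss: "space (gauss n v s) = space (PiM {..<n} (\<lambda>_. borel))"
  by (rule sets_eq_imp_space_eq[OF sets_gauss])

lemma noise_measure_eq_gauss: "noise_measure N n = gauss n (\<lambda>_. 0) (sqrt N)"
  by (simp add: noise_measure_def gauss_def)

lemma prob_space_gauss: "s > 0 \<Longrightarrow> prob_space (gauss n v s)"
  unfolding gauss_def by (intro prob_space_PiM prob_space_normal_density)

lemma product_prob_space_normal:
  assumes "s > 0"
  shows "product_prob_space (\<lambda>i. density lborel (normal_density (v i) s))"
  by (intro product_prob_spaceI prob_space_normal_density assms)

text \<open>Both measures agree on boxes, which determine a product measure. A joint density makes
  Gaussians of different centre and variance comparable point by point.\<close>

lemma gauss_eq_density: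
  assumes s: "s > 0"
  shows "gauss n v s = density (PiM {..<n} (\<lambda>_. lborel)) (\<lambda>y. \<Prod>i<n. ennreal (normal_density (v i) s (y i)))"
proof -
  interpret N: product_prob_space "\<lambda>i. density lborel (normal_density (v i) s)"
    by (rule product_prob_space_normal[OF s])
  interpret L: product_sigma_finite "\<lambda>i::nat. lborel :: real measure" ..
  show ?thesis
    unfolding gauss_def
  proof (rule N.PiM_eqI[symmetric])
    show "sets (density (PiM {..<n} (\<lambda>_. lborel)) (\<lambda>y. \<Prod>i<n. ennreal (normal_density (v i) s (y i)))) =
      sets (Pi\<^sub>M {..<n} (\<lambda>i. density lborel (\<lambda>x. ennreal (normal_density (v i) s x))))"
      by (simp, intro sets_PiM_cong) auto
  next
    fix A :: "nat \<Rightarrow> real set"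
    assume A: "\<And>i. i \<in> {..<n} \<Longrightarrow> A i \<in> sets (density lborel (\<lambda>x. ennreal (normal_density (v i) s x)))"
    then have A'[measurable]: "A i \<in> sets borel" if "i \<in> {..<n}" for i using that by simp
    have PE: "Pi\<^sub>E {..<n} A \<in> sets (PiM {..<n} (\<lambda>_. lborel))"
      using A by (intro sets_PiM_I_finite) auto
    have "emeasure (density (PiM {..<n} (\<lambda>_. lborel)) (\<lambda>y. \<Prod>i<n. ennreal (normal_density (v i) s (y i)))) (Pi\<^sub>E {..<n} A)
      = (\<integral>\<^sup>+y. (\<Prod>i<n. ennreal (normal_density (v i) s (y i))) * indicator (Pi\<^sub>E {..<n} A) y \<partial>PiM {..<n} (\<lambda>_. lborel))"
      using PE by (subst emeasure_density) auto
    also have "\<dots> = (\<integral>\<^sup>+y. (\<Prod>i<n. ennreal (normal_density (v i) s (y i)) * indicator (A i) (y i)) \<partial>PiM {..<n} (\<lambda>_. lborel))"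
    proof (intro nn_integral_cong)
      fix y :: "nat \<Rightarrow> real" assume y: "y \<in> space (Pi\<^sub>M {..<n} (\<lambda>_. lborel))"
      have "indicator (Pi\<^sub>E {..<n} A) y = (\<Prod>i<n. indicator (A i) (y i) :: ennreal)"
      proof (cases "y \<in> Pi\<^sub>E {..<n} A")
        case True
        then show ?thesis by (auto simp: PiE_iff)
      next
        case False
        then obtain i where "i < n" "y i \<notin> A i" using y by (auto simp: space_PiM PiE_iff)
        then have "(\<Prod>i<n. indicator (A i) (y i) :: ennreal) = 0"
          by (intro prod_zero) (auto intro!: bexI[of _ i])
        then show ?thesis using False by simp
      qed
      then show "(\<Prod>i<n. ennreal (normal_density (v i) s (y i))) * indicator (Pi\<^sub>E {..<n} A) y
        = (\<Prod>i<n. ennreal (normal_density (v i) s (y i)) * indicator (A i) (y i))"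
        by (simp add: prod.distrib)
    qed
    also have "\<dots> = (\<Prod>i<n. \<integral>\<^sup>+x. ennreal (normal_density (v i) s x) * indicator (A i) x \<partial>lborel)"
      by (rule L.product_nn_integral_prod) auto
    also have "\<dots> = (\<Prod>i<n. emeasure (density lborel (\<lambda>x. ennreal (normal_density (v i) s x))) (A i))"
      by (intro prod.cong refl) (auto simp: emeasure_density)
    finally show "emeasure (density (PiM {..<n} (\<lambda>_. lborel)) (\<lambda>y. \<Prod>i<n. ennreal (normal_density (v i) s (y i)))) (Pi\<^sub>E {..<n} A) = \<dots>" .
  qed simp
qed

section \<open>Log-likelihoods and change of measure\<close>

lemma normal_density_exp:
  assumes "s > 0"
  shows "normal_density m s x = exp (- ln (2 * pi) / 2 - ln s - (x - m)\<^sup>2 / (2 * s\<^sup>2))"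
proof -
  have "sqrt (2 * pi * s\<^sup>2) = exp (ln (2 * pi) / 2 + ln s)"
    using assms by (simp add: real_sqrt_mult exp_add ln_sqrt[symmetric] exp_minus)
  then show ?thesis
    by (simp add: normal_density_def mult_exp_exp flip: exp_minus inverse_eq_divide)
qed

text \<open>The hypothesis compares log densities, with the common term
  \<open>- n * ln (2 * pi) / 2\<close> cancelled; integrating the pointwise bound over
  \<open>A\<close> gives the claim. Every exponent in the proof comes from this inequality.\<close>

lemma gauss_change_of_measure:
  assumes s: "s > 0" and t: "t > 0" and A: "A \<in> sets (PiM {..<n} (\<lambda>_. borel))"
    and le: "\<And>y. y \<in> A \<Longrightarrow>
      - real n * ln s - (\<Sum>i<n. (y i - v i)\<^sup>2) / (2 * s\<^sup>2) \<le> k - real n * ln t - (\<Sum>i<n. (y i - u i)\<^sup>2) / (2 * t\<^sup>2)"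
  shows "measure (gauss n v s) A \<le> exp k * measure (gauss n u t) A"
proof -
  interpret V: prob_space "gauss n v s" by (rule prob_space_gauss[OF s])
  interpret U: prob_space "gauss n u t" by (rule prob_space_gauss[OF t])
  have dens: "(\<Prod>i<n. ennreal (normal_density (w i) r (y i))) =
      ennreal (exp (- real n * ln (2 * pi) / 2 - real n * ln r - (\<Sum>i<n. (y i - w i)\<^sup>2) / (2 * r\<^sup>2)))"
    if "r > 0" for w r and y :: "nat \<Rightarrow> real"
  proof -
    have "(\<Prod>i<n. ennreal (normal_density (w i) r (y i))) =
       ennreal (exp (\<Sum>i<n. (- ln (2 * pi) / 2 - ln r - (y i - w i)\<^sup>2 / (2 * r\<^sup>2))))"
      by (simp add: prod_ennreal normal_density_exp[OF that] exp_sum)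
    moreover have "(\<Sum>i<n. (- ln (2 * pi) / 2 - ln r - (y i - w i)\<^sup>2 / (2 * r\<^sup>2))) =
        - real n * ln (2 * pi) / 2 - real n * ln r - (\<Sum>i<n. (y i - w i)\<^sup>2) / (2 * r\<^sup>2)"
      unfolding sum_subtractf sum_divide_distrib by (simp add: sum_subtractf)
    ultimately show ?thesis by simp
  qed
  have A': "A \<in> sets (PiM {..<n} (\<lambda>_. lborel :: real measure))"
    using A by (metis sets_PiM_cong sets_lborel)
  have "emeasure (gauss n v s) A = (\<integral>\<^sup>+y. (\<Prod>i<n. ennreal (normal_density (v i) s (y i))) * indicator A y \<partial>PiM {..<n} (\<lambda>_. lborel))"
    unfolding gauss_eq_density[OF s] using A' by (subst emeasure_density) auto
  also have "\<dots> \<le> (\<integral>\<^sup>+y. ennreal (exp k) * ((\<Prod>i<n. ennreal (normal_density (u i) t (y i))) * indicator A y) \<partial>PiM {..<n} (\<lambda>_. lborel))"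
  proof (intro nn_integral_mono)
    fix y
    show "(\<Prod>i<n. ennreal (normal_density (v i) s (y i))) * indicator A y \<le>
      ennreal (exp k) * ((\<Prod>i<n. ennreal (normal_density (u i) t (y i))) * indicator A y)"
      using le[of y] unfolding dens[OF s] dens[OF t]
      by (auto simp: indicator_def ennreal_mult'[symmetric] exp_add[symmetric] intro!: ennreal_leI)
  qed
  also have "\<dots> = ennreal (exp k) * emeasure (gauss n u t) A"
    unfolding gauss_eq_density[OF t] using A'
    by (subst emeasure_density) (auto intro!: nn_integral_cmult)
  finally show ?thesis
    unfolding V.emeasure_eq_measure U.emeasure_eq_measure
    by (simp add: ennreal_mult'[symmetric])
qed

section \<open>Moments, Chebyshev bounds and typical noise\<close>

lemma normal_central_moments:
  assumes s: "s > 0"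
  shows "integrable (density lborel (normal_density m s)) (\<lambda>x. (x - m) ^ k)"
    and "(\<integral>x. x - m \<partial>density lborel (normal_density m s)) = 0"
    and "(\<integral>x. (x - m)\<^sup>2 \<partial>density lborel (normal_density m s)) = s\<^sup>2"
    and "(\<integral>x. (x - m)^4 \<partial>density lborel (normal_density m s)) = 3 * s^4"
  using s integrable_normal_moment[OF s, of m k] integral_normal_moment_odd[OF s, of m 0]
    integral_normal_moment_even[OF s, of m 1] integral_normal_moment_even[OF s, of m 2]
  by (simp_all add: integrable_density integral_density fact_numeral power_divide)

lemma gauss_linear_deviation:
  assumes s: "s > 0" and a: "a > 0"
  shows "measure (gauss n v s) {y \<in> space (gauss n v s). a \<le> \<bar>\<Sum>i<n. b i * (y i - v i)\<bar>}
    \<le> s\<^sup>2 * (\<Sum>i<n. (b i)\<^sup>2) / a\<^sup>2"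
proof -
  interpret prob_space "gauss n v s" by (rule prob_space_gauss[OF s])
  let ?M = "\<lambda>i. density lborel (normal_density (v i) s)"
  let ?g = "\<lambda>i x. b i * (x - v i)"
  have sq: "integrable (?M i) (\<lambda>x. (?g i x)\<^sup>2)" for i
    unfolding power_mult_distrib by (intro integrable_mult_right normal_central_moments s)
  have mean: "(\<integral>x. ?g i x \<partial>?M i) = 0" for i
    using normal_central_moments(2)[OF s, of "v i"] by (simp del: integral_density)
  have var: "(\<integral>x. (?g i x)\<^sup>2 \<partial>?M i) = (b i)\<^sup>2 * s\<^sup>2" for i
    unfolding power_mult_distrib using normal_central_moments(3)[OF s, of "v i"] by simp
  note sm = PiM_second_moment[of "{..<n}" ?M ?g, OF _ prob_space_normal_density[OF s] _ sq mean, folded gauss_def]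
  have "prob {y \<in> space (gauss n v s). a \<le> \<bar>\<Sum>i<n. ?g i (y i)\<bar>} \<le>
    expectation (\<lambda>y. (\<Sum>i<n. ?g i (y i))\<^sup>2) / a\<^sup>2"
    by (rule second_moment_method[OF _ _ a]) (use sm(1) in \<open>simp_all add: gauss_def\<close>)
  also have "expectation (\<lambda>y. (\<Sum>i<n. ?g i (y i))\<^sup>2) = s\<^sup>2 * (\<Sum>i<n. (b i)\<^sup>2)"
    using sm(2) var by (simp add: sum_distrib_left mult.commute)
  finally show ?thesis .
qed

lemma gauss_square_deviation:
  assumes s: "s > 0" and a: "a > 0"
  shows "measure (gauss n v s) {y \<in> space (gauss n v s). a \<le> \<bar>(\<Sum>i<n. (y i - v i)\<^sup>2) - real n * s\<^sup>2\<bar>}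
    \<le> 2 * real n * s^4 / a\<^sup>2"
proof -
  interpret prob_space "gauss n v s" by (rule prob_space_gauss[OF s])
  let ?M = "\<lambda>i. density lborel (normal_density (v i) s)"
  let ?g = "\<lambda>i x. (x - v i)\<^sup>2 - s\<^sup>2"
  have ps: "prob_space (?M i)" for i by (rule prob_space_normal_density[OF s])
  have one: "measure (?M i) UNIV = 1" for i using prob_space.prob_space[OF ps[of i]] by simp
  have const: "integrable (?M i) (\<lambda>_. c)" for i and c :: real
    by (rule finite_measure.integrable_const[OF prob_space.finite_measure[OF ps]])
  have ex: "(?g i x)\<^sup>2 = (x - v i)^4 - (2 * s\<^sup>2) * (x - v i)\<^sup>2 + s^4" for i x
    by (simp add: power2_eq_square power4_eq_xxxx algebra_simps)
  note int = normal_central_moments(1)[OF s]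
  have sq: "integrable (?M i) (\<lambda>x. (?g i x)\<^sup>2)" for i
    unfolding ex by (intro Bochner_Integration.integrable_add Bochner_Integration.integrable_diff
        integrable_mult_right int const)
  have mean: "(\<integral>x. ?g i x \<partial>?M i) = 0" for i
    using normal_central_moments(3)[OF s, of "v i"] int[of "v i" 2] const[of i "s\<^sup>2"]
    by (subst Bochner_Integration.integral_diff) (auto simp: one)
  \<comment> \<open>The fourth central moment is \<open>3 * s^4\<close>, so the squared deviation
    has variance \<open>(3 - 2 + 1) * s^4\<close>.\<close>
  have var: "(\<integral>x. (?g i x)\<^sup>2 \<partial>?M i) = 2 * s^4" for i
  proof -
    have "(\<integral>x. (?g i x)\<^sup>2 \<partial>?M i) = 3 * s^4 - (2 * s\<^sup>2) * s\<^sup>2 + s^4"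
      unfolding ex using normal_central_moments(3,4)[OF s, of "v i"] int[of "v i"] const[of i]
      by (subst Bochner_Integration.integral_add Bochner_Integration.integral_diff;
          auto simp: one intro!: Bochner_Integration.integrable_diff)+
    then show ?thesis by (simp add: power2_eq_square power4_eq_xxxx)
  qed
  note sm = PiM_second_moment[of "{..<n}" ?M ?g, OF _ ps _ sq mean, folded gauss_def]
  have "prob {y \<in> space (gauss n v s). a \<le> \<bar>\<Sum>i<n. ?g i (y i)\<bar>} \<le>
    expectation (\<lambda>y. (\<Sum>i<n. ?g i (y i))\<^sup>2) / a\<^sup>2"
    by (rule second_moment_method[OF _ _ a]) (use sm(1) in \<open>simp_all add: gauss_def\<close>)
  also have "expectation (\<lambda>y. (\<Sum>i<n. ?g i (y i))\<^sup>2) = 2 * real n * s^4"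
    using sm(2) var by simp
  finally show ?thesis by (simp add: sum_subtractf)
qed

text \<open>The variances grow linearly in \<open>n\<close> while the squared threshold grows like
  \<open>n\<close> squared, so both failure probabilities are of order \<open>1 / n\<close>. The
  threshold \<open>n0\<close> is uniform in \<open>v\<close> and \<open>b\<close>, as it must be
  because codewords change with \<open>n\<close>.\<close>

lemma gauss_typical:
  assumes s: "s > 0" and d: "d > 0" and e: "e > 0"
  shows "\<exists>n0>0. \<forall>n\<ge>n0. \<forall>v (b :: nat \<Rightarrow> real). (\<Sum>i<n. (b i)\<^sup>2) \<le> n * K \<longrightarrow>
    measure (gauss n v s) {y \<in> space (gauss n v s). \<bar>\<Sum>i<n. b i * (y i - v i)\<bar> < n * d \<and>
      \<bar>(\<Sum>i<n. (y i - v i)\<^sup>2) - real n * s\<^sup>2\<bar> < n * d} \<ge> 1 - e"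
proof -
  \<comment> \<open>\<open>c / n\<close> is the sum of the two Chebyshev bounds at deviation
    \<open>n * d\<close>.\<close>
  define c where "c = (s\<^sup>2 * K + 2 * s^4) / d\<^sup>2"
  define n0 where "n0 = nat \<lceil>c / e\<rceil> + 1"
  have "1 - e \<le> measure (gauss n v s) {y \<in> space (gauss n v s). \<bar>\<Sum>i<n. b i * (y i - v i)\<bar> < n * d \<and>
      \<bar>(\<Sum>i<n. (y i - v i)\<^sup>2) - real n * s\<^sup>2\<bar> < n * d}" (is "_ \<le> measure ?G ?A")
    if n: "n \<ge> n0" and b: "(\<Sum>i<n. (b i)\<^sup>2) \<le> n * K" for n v and b :: "nat \<Rightarrow> real"
  proof -
    interpret prob_space ?G by (rule prob_space_gauss[OF s])
    have n_pos: "real n > 0" using n by (simp add: n0_def)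
    then have nd: "n * d > 0" using d by simp
    have "c / e \<le> n" using n unfolding n0_def by linarith
    then have cn: "c / n \<le> e" using e n_pos by (simp add: field_simps)
    let ?B = "{y \<in> space ?G. n * d \<le> \<bar>\<Sum>i<n. b i * (y i - v i)\<bar>}"
    let ?C = "{y \<in> space ?G. n * d \<le> \<bar>(\<Sum>i<n. (y i - v i)\<^sup>2) - real n * s\<^sup>2\<bar>}"
    have [measurable]: "?A \<in> events" "?B \<in> events" "?C \<in> events" by (simp_all add: gauss_def)
    have "1 - prob ?A = prob (space ?G - ?A)" by (simp add: prob_compl)
    also have "\<dots> = prob (?B \<union> ?C)" by (intro arg_cong[where f=prob]) auto
    also have "\<dots> \<le> prob ?B + prob ?C" by (intro measure_Un_le) auto
    also have "\<dots> \<le> s\<^sup>2 * (n * K) / (n * d)\<^sup>2 + 2 * real n * s^4 / (n * d)\<^sup>2"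
    proof (intro add_mono)
      have "prob ?B \<le> s\<^sup>2 * (\<Sum>i<n. (b i)\<^sup>2) / (n * d)\<^sup>2"
        by (rule gauss_linear_deviation[OF s nd])
      also have "\<dots> \<le> s\<^sup>2 * (n * K) / (n * d)\<^sup>2"
        using b by (intro divide_right_mono mult_left_mono) auto
      finally show "prob ?B \<le> \<dots>" .
    qed (rule gauss_square_deviation[OF s nd])
    also have "\<dots> = c / n"
      using n_pos d by (simp add: c_def field_simps power2_eq_square)
    finally show ?thesis using cn by simp
  qed
  then show ?thesis by (intro exI[of _ n0]) (auto simp: n0_def)
qed

section \<open>Translation and convolution\<close>

lemma gauss_shift:
  assumes s: "s > 0"
  shows "distr (gauss n (\<lambda>_. 0) s) (PiM {..<n} (\<lambda>_. borel)) (\<lambda>z. \<lambda>i\<in>{..<n}. x i + z i) = gauss n x s"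
proof -
  let ?N = "\<lambda>m. density lborel (normal_density m s)"
  have shift: "emeasure (?N 0) ((+) c -` A) = emeasure (?N c) A" if A[measurable]: "A \<in> sets borel" for c A
  proof -
    interpret prob_space "?N 0" by (rule prob_space_normal_density[OF s])
    have "distributed (?N 0) lborel (\<lambda>y. y) (normal_density 0 s)"
      by (simp add: distributed_def distr_id2)
    from normal_density_affine[OF this s, of 1 c]
    have "distr (?N 0) lborel (\<lambda>y. c + y) = ?N c"
      by (simp add: distributed_def)
    then have "emeasure (?N c) A = emeasure (distr (?N 0) lborel (\<lambda>y. c + y)) A" by simp
    then show ?thesis by (subst (asm) emeasure_distr) auto
  qed
  have pre: "(+) c -` A \<in> sets borel" if "A \<in> sets borel" for c :: real and A
    using measurable_sets[of "(+) c" borel borel A] that by simp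
  interpret X: product_prob_space "\<lambda>i. ?N (x i)" by (rule product_prob_space_normal[OF s])
  interpret Z: product_prob_space "\<lambda>_::nat. ?N 0" by (rule product_prob_space_normal[OF s])
  let ?f = "\<lambda>z. \<lambda>i\<in>{..<n}. x i + z i"
  show ?thesis unfolding gauss_def[of n x]
  proof (rule X.PiM_eqI)
    show "sets (distr (gauss n (\<lambda>_. 0) s) (PiM {..<n} (\<lambda>_. borel)) ?f) = sets (PiM {..<n} (\<lambda>i. ?N (x i)))"
      by (simp, intro sets_PiM_cong) auto
  next
    fix A :: "nat \<Rightarrow> real set" assume "\<And>i. i \<in> {..<n} \<Longrightarrow> A i \<in> sets (?N (x i))"
    then have A: "A i \<in> sets borel" if "i < n" for i using that by simp
    have "emeasure (distr (gauss n (\<lambda>_. 0) s) (PiM {..<n} (\<lambda>_. borel)) ?f) (Pi\<^sub>E {..<n} A)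
      = emeasure (gauss n (\<lambda>_. 0) s) (?f -` Pi\<^sub>E {..<n} A \<inter> space (gauss n (\<lambda>_. 0) s))"
      using A by (intro emeasure_distr sets_PiM_I_finite) (auto, measurable)
    also have "?f -` Pi\<^sub>E {..<n} A \<inter> space (gauss n (\<lambda>_. 0) s) = Pi\<^sub>E {..<n} (\<lambda>i. (+) (x i) -` A i)"
      by (auto simp: space_gauss space_PiM PiE_iff)
    also have "emeasure (gauss n (\<lambda>_. 0) s) \<dots> = (\<Prod>i<n. emeasure (?N 0) ((+) (x i) -` A i))"
      unfolding gauss_def using A by (intro Z.emeasure_PiM) (auto intro!: pre)
    also have "\<dots> = (\<Prod>i<n. emeasure (?N (x i)) (A i))"
      using A by (intro prod.cong refl shift) auto
    finally show "emeasure (distr (gauss n (\<lambda>_. 0) s) (PiM {..<n} (\<lambda>_. borel)) ?f) (Pi\<^sub>E {..<n} A)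
      = (\<Prod>i<n. emeasure (?N (x i)) (A i))" .
  qed simp
qed

lemma normal_convolution:
  assumes r: "r > 0" and s: "s > 0" and A[measurable]: "A \<in> sets borel"
  shows "(\<integral>\<^sup>+c. emeasure (density lborel (normal_density c s)) A \<partial>density lborel (normal_density 0 r)) =
    emeasure (density lborel (normal_density 0 (sqrt (r\<^sup>2 + s\<^sup>2)))) A" (is "?L = _")
    and "(\<lambda>c. emeasure (density lborel (normal_density c s)) A) \<in> borel_measurable borel" (is ?M)
proof -
  have em: "emeasure (density lborel (normal_density c s)) A = (\<integral>\<^sup>+x. ennreal (normal_density 0 s (x - c)) * indicator A x \<partial>lborel)" for c
    by (subst emeasure_density) (auto simp: normal_density_def intro!: nn_integral_cong)
  show ?M unfolding em by measurable
  then have "?L = (\<integral>\<^sup>+c. ennreal (normal_density 0 r c) * (\<integral>\<^sup>+x. ennreal (normal_density 0 s (x - c)) * indicator A x \<partial>lborel) \<partial>lborel)"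
    by (subst nn_integral_density) (auto simp: em)
  also have "\<dots> = (\<integral>\<^sup>+c. \<integral>\<^sup>+x. ennreal (normal_density 0 s (x - c) * normal_density 0 r c) * indicator A x \<partial>lborel \<partial>lborel)"
    by (subst nn_integral_cmult[symmetric]) (auto intro!: nn_integral_cong simp: ennreal_mult' mult_ac)
  also have "\<dots> = (\<integral>\<^sup>+x. \<integral>\<^sup>+c. ennreal (normal_density 0 s (x - c) * normal_density 0 r c) * indicator A x \<partial>lborel \<partial>lborel)"
    by (rule lborel_pair.Fubini') measurable
  also have "\<dots> = (\<integral>\<^sup>+x. (\<integral>\<^sup>+c. ennreal (normal_density 0 s (x - c) * normal_density 0 r c) \<partial>lborel) * indicator A x \<partial>lborel)"
    by (intro nn_integral_cong nn_integral_multc) auto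
  also have "\<dots> = (\<integral>\<^sup>+x. ennreal (normal_density 0 (sqrt (r\<^sup>2 + s\<^sup>2)) x) * indicator A x \<partial>lborel)"
    using fun_cong[OF conv_normal_density_zero_mean[OF s r]] by (simp add: add.commute)
  finally show "?L = emeasure (density lborel (normal_density 0 (sqrt (r\<^sup>2 + s\<^sup>2)))) A"
    by (subst emeasure_density) auto
qed

text \<open>Averaging the output law over a random codeword with independent coordinates of variance
  \<open>r\<^sup>2\<close> gives independent outputs of variance
  \<open>r\<^sup>2 + s\<^sup>2\<close>: codeword plus noise is the sum of two independent Gaussian
  vectors.\<close>

lemma gauss_convolution:
  assumes r: "r > 0" and s: "s > 0" and U: "U \<in> sets (PiM {..<n} (\<lambda>_. borel))"
  shows "(\<integral>\<^sup>+c. emeasure (gauss n c s) U \<partial>gauss n (\<lambda>_. 0) r) =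
    emeasure (gauss n (\<lambda>_. 0) (sqrt (r\<^sup>2 + s\<^sup>2))) U"
proof -
  let ?t = "sqrt (r\<^sup>2 + s\<^sup>2)"
  let ?B = "PiM {..<n} (\<lambda>_. borel :: real measure)"
  let ?N = "\<lambda>m s. density lborel (normal_density m s)"
  have t: "?t > 0" using r s by (simp add: add_pos_pos)
  let ?R = "gauss n (\<lambda>_. 0) r" and ?S = "gauss n (\<lambda>_. 0) s"
  let ?add = "\<lambda>p. \<lambda>i\<in>{..<n}. fst p i + snd p i :: real"
  interpret R: prob_space ?R by (rule prob_space_gauss[OF r])
  interpret S: prob_space ?S by (rule prob_space_gauss[OF s])
  interpret RS: pair_prob_space ?R ?S ..
  have [measurable]: "?add \<in> ?R \<Otimes>\<^sub>M ?S \<rightarrow>\<^sub>M ?B" by measurable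
  \<comment> \<open>Stated for every measurable \<open>V\<close>, since it is used twice: on boxes
    to identify the law of the sum, and at the end on \<open>U\<close>.\<close>
  have distr: "emeasure (distr (?R \<Otimes>\<^sub>M ?S) ?B ?add) V = (\<integral>\<^sup>+c. emeasure (gauss n c s) V \<partial>?R)"
    if V[measurable]: "V \<in> sets ?B" for V
  proof -
    have "emeasure (distr (?R \<Otimes>\<^sub>M ?S) ?B ?add) V
      = (\<integral>\<^sup>+c. emeasure ?S (Pair c -` (?add -` V \<inter> space (?R \<Otimes>\<^sub>M ?S))) \<partial>?R)"
      by (subst emeasure_distr, measurable) (rule S.emeasure_pair_measure_alt, measurable)
    also have "\<dots> = (\<integral>\<^sup>+c. emeasure (gauss n c s) V \<partial>?R)"
    proof (intro nn_integral_cong)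
      fix c assume c: "c \<in> space ?R"
      have "emeasure (gauss n c s) V = emeasure ?S ((\<lambda>z. \<lambda>i\<in>{..<n}. c i + z i) -` V \<inter> space ?S)"
        unfolding gauss_shift[OF s, of n c, symmetric] by (subst emeasure_distr) auto
      also have "(\<lambda>z. \<lambda>i\<in>{..<n}. c i + z i) -` V \<inter> space ?S = Pair c -` (?add -` V \<inter> space (?R \<Otimes>\<^sub>M ?S))"
        using c by (auto simp: space_pair_measure)
      finally show "emeasure ?S (Pair c -` (?add -` V \<inter> space (?R \<Otimes>\<^sub>M ?S))) = emeasure (gauss n c s) V" ..
    qed
    finally show ?thesis .
  qed
  interpret T: product_prob_space "\<lambda>_::nat. ?N 0 ?t" by (rule product_prob_space_normal[OF t])
  interpret P: product_prob_space "\<lambda>_::nat. ?N 0 r" by (rule product_prob_space_normal[OF r])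
  have "distr (?R \<Otimes>\<^sub>M ?S) ?B ?add = gauss n (\<lambda>_. 0) ?t"
    unfolding gauss_def[of n "\<lambda>_. 0" ?t]
  proof (rule T.PiM_eqI)
    show "sets (distr (?R \<Otimes>\<^sub>M ?S) ?B ?add) = sets (PiM {..<n} (\<lambda>_. ?N 0 ?t))"
      by (simp, intro sets_PiM_cong) auto
  next
    fix A :: "nat \<Rightarrow> real set" assume "\<And>i. i \<in> {..<n} \<Longrightarrow> A i \<in> sets (?N 0 ?t)"
    then have A: "A i \<in> sets borel" if "i < n" for i using that by simp
    have "emeasure (distr (?R \<Otimes>\<^sub>M ?S) ?B ?add) (Pi\<^sub>E {..<n} A)
      = (\<integral>\<^sup>+c. emeasure (gauss n c s) (Pi\<^sub>E {..<n} A) \<partial>?R)"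
      using A by (intro distr sets_PiM_I_finite) auto
    also have "\<dots> = (\<integral>\<^sup>+c. (\<Prod>i<n. emeasure (?N (c i) s) (A i)) \<partial>PiM {..<n} (\<lambda>_. ?N 0 r))"
      unfolding gauss_def[of n "\<lambda>_. 0" r]
    proof (intro nn_integral_cong)
      fix c
      interpret C: product_prob_space "\<lambda>i::nat. ?N (c i) s" by (rule product_prob_space_normal[OF s])
      show "emeasure (gauss n c s) (Pi\<^sub>E {..<n} A) = (\<Prod>i<n. emeasure (?N (c i) s) (A i))"
        unfolding gauss_def using A by (subst C.emeasure_PiM) auto
    qed
    also have "\<dots> = (\<Prod>i<n. \<integral>\<^sup>+c. emeasure (?N c s) (A i) \<partial>?N 0 r)"
      by (rule P.product_nn_integral_prod) (auto intro!: normal_convolution(2)[OF r s A])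
    also have "\<dots> = (\<Prod>i<n. emeasure (?N 0 ?t) (A i))"
      by (intro prod.cong refl normal_convolution(1)[OF r s A]) auto
    finally show "emeasure (distr (?R \<Otimes>\<^sub>M ?S) ?B ?add) (Pi\<^sub>E {..<n} A) = (\<Prod>i<n. emeasure (?N 0 ?t) (A i))" .
  qed simp
  then show ?thesis using distr[OF U] by simp
qed

lemma out_prob_eq_gauss:
  assumes N: "N > 0" and D: "D \<in> PiM {..<n} (\<lambda>_. borel) \<rightarrow>\<^sub>M count_space UNIV"
  shows "out_prob N n x D w S = measure (gauss n (x w) (sqrt N)) {y \<in> space (PiM {..<n} (\<lambda>_. borel)). S (D y)}"
proof -
  note D[measurable]
  show ?thesis
    unfolding out_prob_def noise_measure_eq_gauss
    by (subst gauss_shift[symmetric]; (subst measure_distr)?)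
      (use N in \<open>auto intro!: arg_cong[where f="measure _"] simp: space_gauss space_PiM\<close>)
qed

subsection \<open>Achievability\<close>

text \<open>The output law is the average of the laws \<open>gauss n c s\<close> over random
  \<open>c\<close>, and the part of the average coming from \<open>F\<close> already contributes
  this much.\<close>

lemma gauss_mixture_ge:
  assumes r: "r > 0" and s: "s > 0" and U: "U \<in> sets (PiM {..<n} (\<lambda>_. borel))"
    and F: "F \<in> sets (PiM {..<n} (\<lambda>_. borel))" and a: "a \<ge> 0"
    and ge: "\<And>c. c \<in> F \<Longrightarrow> a \<le> measure (gauss n c s) U"
  shows "a * measure (gauss n (\<lambda>_. 0) r) F \<le> measure (gauss n (\<lambda>_. 0) (sqrt (r\<^sup>2 + s\<^sup>2))) U"
proof -
  have t: "sqrt (r\<^sup>2 + s\<^sup>2) > 0" using r s by (simp add: add_pos_pos)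
  interpret R: prob_space "gauss n (\<lambda>_. 0) r" by (rule prob_space_gauss[OF r])
  interpret T: prob_space "gauss n (\<lambda>_. 0) (sqrt (r\<^sup>2 + s\<^sup>2))" by (rule prob_space_gauss[OF t])
  have "ennreal (a * R.prob F) = (\<integral>\<^sup>+c. ennreal a * indicator F c \<partial>gauss n (\<lambda>_. 0) r)"
    using F a by (subst nn_integral_cmult_indicator) (auto simp: sets_gauss R.emeasure_eq_measure ennreal_mult')
  also have "\<dots> \<le> (\<integral>\<^sup>+c. emeasure (gauss n c s) U \<partial>gauss n (\<lambda>_. 0) r)"
  proof (intro nn_integral_mono)
    fix c
    interpret C: prob_space "gauss n c s" by (rule prob_space_gauss[OF s])
    show "ennreal a * indicator F c \<le> emeasure (gauss n c s) U"
      using ge[of c] by (auto simp: indicator_def C.emeasure_eq_measure intro: ennreal_leI)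
  qed
  finally show ?thesis
    unfolding gauss_convolution[OF r s U] T.emeasure_eq_measure by simp
qed

text \<open>Feinstein's maximal coding argument: as long as the decoding sets chosen so far are small
  under the output distribution, some admissible codeword rarely produces an output in their union.\<close>

lemma feinstein:
  fixes e g :: real and n k :: nat and F :: "(nat \<Rightarrow> real) set"
  defines "B \<equiv> sets (PiM {..<n} (\<lambda>_. borel :: real measure))"
  assumes r: "r > 0" and s: "s > 0" and F: "F \<in> B"
    and half: "measure (gauss n (\<lambda>_. 0) r) F \<ge> 1/2"
    and G: "\<And>c. c \<in> F \<Longrightarrow> G c \<in> B"
    and typical: "\<And>c. c \<in> F \<Longrightarrow> measure (gauss n c s) (G c) \<ge> 1 - e/2"
    and small: "\<And>c. c \<in> F \<Longrightarrow> measure (gauss n (\<lambda>_. 0) (sqrt (r\<^sup>2 + s\<^sup>2))) (G c) \<le> g"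
    and e: "e > 0" and k: "k * g < e / 4" and g: "g \<ge> 0"
  shows "\<exists>c A. disjoint_family_on A {1..k} \<and> (\<forall>w\<in>{1..k}. c w \<in> F \<and> A w \<in> B \<and> A w \<subseteq> G (c w) \<and>
    measure (gauss n (c w) s) (A w) \<ge> 1 - e)"
  using k
proof (induction k)
  case 0
  then show ?case by (auto simp: disjoint_family_on_def)
next
  case (Suc k)
  let ?Q = "gauss n (\<lambda>_. 0) (sqrt (r\<^sup>2 + s\<^sup>2))"
  have t: "sqrt (r\<^sup>2 + s\<^sup>2) > 0" using r s by (simp add: add_pos_pos)
  interpret Q: prob_space ?Q by (rule prob_space_gauss[OF t])
  have setsQ: "sets (gauss n v x) = B" for v x by (simp add: sets_gauss B_def)
  have kg: "k * g < e / 4" using Suc.prems g by (simp add: algebra_simps)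
  then obtain c A where disj: "disjoint_family_on A {1..k}"
    and cA: "\<And>w. w \<in> {1..k} \<Longrightarrow> c w \<in> F \<and> A w \<in> B \<and> A w \<subseteq> G (c w) \<and> measure (gauss n (c w) s) (A w) \<ge> 1 - e"
    using Suc.IH by blast
  define U where "U = (\<Union>w\<in>{1..k}. A w)"
  have U: "U \<in> B" unfolding U_def B_def using cA by (intro sets.finite_UN) (auto simp: B_def)
  have "Q.prob U \<le> (\<Sum>w\<in>{1..k}. Q.prob (A w))"
    unfolding U_def using cA by (intro Q.finite_measure_subadditive_finite) (auto simp: setsQ)
  also have "\<dots> \<le> (\<Sum>w\<in>{1..k}. g)"
  proof (intro sum_mono)
    fix w assume "w \<in> {1..k}"
    then have "c w \<in> F" "A w \<subseteq> G (c w)" using cA by auto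
    then show "Q.prob (A w) \<le> g"
      using small[of "c w"] G[of "c w"] Q.finite_measure_mono[of "A w" "G (c w)"] by (simp add: setsQ)
  qed
  finally have QU: "Q.prob U < e / 4" using kg by simp
  \<comment> \<open>If every codeword of \<open>F\<close> hit \<open>U\<close> with probability at
    least \<open>e / 2\<close>, then averaging over \<open>F\<close>, which has mass at least 1/2,
    would give \<open>U\<close> output probability at least \<open>e / 4\<close>.\<close>
  have "\<exists>c'\<in>F. measure (gauss n c' s) U < e / 2"
  proof (rule ccontr)
    assume "\<not> ?thesis"
    then have "e / 2 * measure (gauss n (\<lambda>_. 0) r) F \<le> Q.prob U"
      using U F e by (intro gauss_mixture_ge[OF r s]) (auto simp: B_def not_less)
    moreover have "e / 2 * (1/2) \<le> e / 2 * measure (gauss n (\<lambda>_. 0) r) F"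
      using half e by (intro mult_left_mono) auto
    ultimately show False using QU by simp
  qed
  then obtain c' where c': "c' \<in> F" and c'U: "measure (gauss n c' s) U < e / 2" by blast
  interpret P: prob_space "gauss n c' s" by (rule prob_space_gauss[OF s])
  have "P.prob (G c') \<le> P.prob ((G c' - U) \<union> U)"
    using G[OF c'] U by (intro P.finite_measure_mono) (auto simp: sets_gauss B_def)
  also have "\<dots> \<le> P.prob (G c' - U) + P.prob U"
    using G[OF c'] U by (intro measure_Un_le) (auto simp: sets_gauss B_def)
  finally have PU: "P.prob (G c' - U) \<ge> 1 - e"
    using typical[OF c'] c'U by simp
  \<comment> \<open>The new decoding set is the typical set minus the earlier ones: atypical noise
    costs \<open>e / 2\<close> and the removed overlap another \<open>e / 2\<close>.\<close>
  let ?c = "c(Suc k := c')" and ?A = "A(Suc k := G c' - U)"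
  have "disjoint_family_on ?A {1..Suc k}"
    unfolding disjoint_family_on_def
  proof (intro ballI impI)
    fix m l assume ml: "m \<in> {1..Suc k}" "l \<in> {1..Suc k}" "m \<noteq> l"
    show "?A m \<inter> ?A l = {}"
      using disjoint_family_onD[OF disj, of m l] ml
      by (cases "m = Suc k"; cases "l = Suc k") (auto simp: U_def)
  qed
  moreover have "\<forall>w\<in>{1..Suc k}. ?c w \<in> F \<and> ?A w \<in> B \<and> ?A w \<subseteq> G (?c w) \<and> measure (gauss n (?c w) s) (?A w) \<ge> 1 - e"
  proof
    fix w assume "w \<in> {1..Suc k}"
    then show "?c w \<in> F \<and> ?A w \<in> B \<and> ?A w \<subseteq> G (?c w) \<and> measure (gauss n (?c w) s) (?A w) \<ge> 1 - e"
      using cA[of w] c' PU G[OF c'] U by (cases "w = Suc k") (auto simp: B_def)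
  qed
  ultimately show ?case by blast
qed

text \<open>Outputs outside all decoding sets are declared a red alert. A missed detection thus
  requires landing in some \<open>A w\<close>, which the union bound controls, and the conditioning
  event in \<open>p_MSG\<close> has probability at least \<open>1 - e\<close>.\<close>

lemma decoder_from_sets:
  fixes A :: "nat \<Rightarrow> (nat \<Rightarrow> real) set"
  assumes N: "N > 0" and disj: "disjoint_family_on A {1..k}"
    and A: "\<And>w. w \<in> {1..k} \<Longrightarrow> A w \<in> sets (PiM {..<n} (\<lambda>_. borel))"
    and good: "\<And>w. w \<in> {1..k} \<Longrightarrow> measure (gauss n (c w) (sqrt N)) (A w) \<ge> 1 - e"
    and alert: "\<And>w. w \<in> {1..k} \<Longrightarrow> measure (gauss n (c 0) (sqrt N)) (A w) \<le> q"
    and e: "0 \<le> e" "e < 1" and k: "k > 0"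
  shows "\<exists>D. D \<in> PiM {..<n} (\<lambda>_. borel) \<rightarrow>\<^sub>M count_space UNIV \<and> (\<forall>y. D y \<le> k) \<and>
    p_MD N n c D \<le> k * q \<and> p_FA N n k c D \<le> e \<and> p_MSG N n k c D \<le> e / (1 - e)"
proof -
  let ?B = "PiM {..<n} (\<lambda>_. borel :: real measure)"
  \<comment> \<open>By disjointness at most one summand is nonzero, and the empty case gives the
    default 0. Written as a sum, the decoder is visibly measurable.\<close>
  define D where "D y = (\<Sum>w\<in>{1..k}. if y \<in> A w then w else 0)" for y
  have D_in: "D y = w" if "w \<in> {1..k}" "y \<in> A w" for y w
  proof -
    have "D y = (\<Sum>v\<in>{1..k}. if v = w then w else 0)"
      unfolding D_def
    proof (intro sum.cong refl)
      fix v assume v: "v \<in> {1..k}"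
      show "(if y \<in> A v then v else 0) = (if v = w then w else 0)"
        using that(2) disjoint_family_onD[OF disj v that(1)] by auto
    qed
    then show ?thesis using that by simp
  qed
  have D_out: "D y = 0" if "\<And>w. w \<in> {1..k} \<Longrightarrow> y \<notin> A w" for y
    unfolding D_def using that by (intro sum.neutral) auto
  have D_le: "D y \<le> k" for y
  proof (cases "\<exists>w\<in>{1..k}. y \<in> A w")
    case True
    then show ?thesis using D_in by auto
  next
    case False
    then show ?thesis using D_out[of y] by auto
  qed
  have "D \<in> borel_measurable ?B"
    unfolding D_def[abs_def] using A
    by (intro borel_measurable_sum measurable_If_set) (auto intro: sets.Int)
  then have D[measurable]: "D \<in> ?B \<rightarrow>\<^sub>M count_space UNIV"
    by (metis measurable_cong_sets sets_borel_eq_count_space)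
  have s: "sqrt N > 0" using N by simp
  have P: "prob_space (gauss n v (sqrt N))" for v by (rule prob_space_gauss[OF s])
  note out = out_prob_eq_gauss[OF N D]
  have sets: "{y \<in> space ?B. S (D y)} \<in> sets (gauss n v (sqrt N))" for S v
    by (simp add: sets_gauss)
  have wrong: "out_prob N n c D w S \<le> e" if w: "w \<in> {1..k}" and S: "\<not> S w" for w S
  proof -
    interpret prob_space "gauss n (c w) (sqrt N)" by (rule P)
    have Aw: "A w \<in> events" using A[OF w] by (simp add: sets_gauss)
    have "prob {y \<in> space ?B. S (D y)} \<le> prob (space (gauss n (c w) (sqrt N)) - A w)"
      using D_in[OF w] S Aw by (intro finite_measure_mono) (auto simp: space_gauss)
    then show ?thesis unfolding out using good[OF w] prob_compl[OF Aw] by simp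
  qed
  have "p_MD N n c D \<le> (\<Sum>w\<in>{1..k}. measure (gauss n (c 0) (sqrt N)) (A w))"
  proof -
    interpret prob_space "gauss n (c 0) (sqrt N)" by (rule P)
    have "{y \<in> space ?B. D y \<noteq> 0} \<subseteq> (\<Union>w\<in>{1..k}. A w)"
      using D_out by (metis (mono_tags, lifting) UN_iff mem_Collect_eq subsetI)
    then have "prob {y \<in> space ?B. D y \<noteq> 0} \<le> prob (\<Union>w\<in>{1..k}. A w)"
      using A by (intro finite_measure_mono sets.finite_UN) (auto simp: sets_gauss)
    also have "\<dots> \<le> (\<Sum>w\<in>{1..k}. prob (A w))"
      using A by (intro finite_measure_subadditive_finite) (auto simp: sets_gauss)
    finally show ?thesis by (simp add: p_MD_def out)
  qed
  also have "\<dots> \<le> (\<Sum>w\<in>{1..k}. q)" by (intro sum_mono alert)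
  finally have MD: "p_MD N n c D \<le> k * q" by simp
  have avg: "(1 / real k) * (\<Sum>w\<in>{1..k}. f w) \<le> a" if "\<And>w. w \<in> {1..k} \<Longrightarrow> f w \<le> a" for f a
    using sum_mono[of "{1..k}" f "\<lambda>_. a"] that k by (simp add: field_simps)
  have FA: "p_FA N n k c D \<le> e"
    unfolding p_FA_def by (intro avg wrong) auto
  have MSG: "p_MSG N n k c D \<le> e / (1 - e)"
    unfolding p_MSG_def
  proof (intro avg)
    fix w assume w: "w \<in> {1..k}"
    interpret prob_space "gauss n (c w) (sqrt N)" by (rule P)
    have "A w \<subseteq> space ?B" using A[OF w] by (rule sets.sets_into_space)
    then have "prob (A w) \<le> prob {y \<in> space ?B. D y \<noteq> 0}"
      using D_in[OF w] w sets by (intro finite_measure_mono) auto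
    then have "1 - e \<le> out_prob N n c D w (\<lambda>v. v \<noteq> 0)"
      unfolding out using good[OF w] by simp
    moreover have "out_prob N n c D w (\<lambda>v. v \<noteq> w \<and> v \<noteq> 0) \<le> e"
      by (rule wrong[OF w]) simp
    ultimately show "out_prob N n c D w (\<lambda>v. v \<noteq> w \<and> v \<noteq> 0) / out_prob N n c D w (\<lambda>v. v \<noteq> 0) \<le> e / (1 - e)"
      using e by (intro frac_le) (auto simp: out_prob_def)
  qed
  show ?thesis using D D_le MD FA MSG by blast
qed

text \<open>Only relative positions of codewords affect error probabilities. The code can therefore
  be built around the origin and moved afterwards to meet the power constraints.\<close>

lemma out_prob_translate:
  "out_prob N n (\<lambda>w i. a + x w i) (\<lambda>y. D (\<lambda>i\<in>{..<n}. y i - a)) = out_prob N n x D"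
proof -
  have "(\<lambda>i\<in>{..<n}. (\<lambda>i\<in>{..<n}. a + x w i + z i) i - a) = (\<lambda>i\<in>{..<n}. x w i + z i)" for w and z :: "nat \<Rightarrow> real"
    by auto
  then show ?thesis by (intro ext) (simp add: out_prob_def)
qed

lemma measurable_translate:
  assumes [measurable]: "D \<in> PiM {..<n} (\<lambda>_. borel) \<rightarrow>\<^sub>M M"
  shows "(\<lambda>y. D (\<lambda>i\<in>{..<n}. y i - (a::real))) \<in> PiM {..<n} (\<lambda>_. borel) \<rightarrow>\<^sub>M M"
  by measurable

text \<open>Coordinates are chosen so that ordinary codewords are centred at the origin, and
  \<open>b\<close> is the offset of the red alert codeword in each coordinate. Feinstein's argument
  with a Gaussian prior of variance \<open>P\<close> supplies the code; the terms in
  \<open>d\<close> are the price of working with typical sets.\<close>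

lemma red_alert_code_exists:
  fixes N P b d e :: real
  assumes N: "N > 0" and P: "P > 0" and b: "b \<ge> 0" and d: "d > 0" and e: "0 < e" "e < 1"
  defines "C \<equiv> ln (1 + P / N) / 2"
  shows "\<exists>n0>0. \<forall>n\<ge>n0. \<forall>M>0. M * exp (- real n * (C - d * (2 / (P + N) + 1 / (2 * N)))) < e / 4 \<longrightarrow>
    (\<exists>c D. D \<in> PiM {..<n} (\<lambda>_. borel) \<rightarrow>\<^sub>M count_space UNIV \<and> (\<forall>y. D y \<le> M) \<and> c 0 = (\<lambda>_. - b) \<and>
      (\<forall>w\<in>{1..M}. \<bar>\<Sum>i<n. c w i\<bar> < n * d \<and> \<bar>(\<Sum>i<n. (c w i)\<^sup>2) - real n * P\<bar> < n * d) \<and>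
      p_MD N n c D \<le> M * exp (- real n * ((P + b\<^sup>2 - d * (3 + 4 * b)) / (2 * N))) \<and>
      p_FA N n M c D \<le> e \<and> p_MSG N n M c D \<le> e / (1 - e))"
proof -
  have s: "sqrt N > 0" and r: "sqrt P > 0" using N P by auto
  obtain n1 where n1: "n1 > 0" and typ_prior: "\<And>n v (f :: nat \<Rightarrow> real). n \<ge> n1 \<Longrightarrow> (\<Sum>i<n. (f i)\<^sup>2) \<le> n * 1 \<Longrightarrow>
    1 - 1/2 \<le> measure (gauss n v (sqrt P)) {y \<in> space (gauss n v (sqrt P)). \<bar>\<Sum>i<n. f i * (y i - v i)\<bar> < n * d \<and>
      \<bar>(\<Sum>i<n. (y i - v i)\<^sup>2) - real n * (sqrt P)\<^sup>2\<bar> < n * d}"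
    using gauss_typical[OF r d, of "1/2" 1] by auto
  \<comment> \<open>The bound \<open>P + d + 1\<close> covers both directions in which the noise is
    tested: a codeword of power below \<open>P + d\<close>, and the all-ones vector.\<close>
  obtain n2 where n2: "n2 > 0" and typ_noise: "\<And>n v (f :: nat \<Rightarrow> real). n \<ge> n2 \<Longrightarrow> (\<Sum>i<n. (f i)\<^sup>2) \<le> n * (P + d + 1) \<Longrightarrow>
    1 - e/4 \<le> measure (gauss n v (sqrt N)) {y \<in> space (gauss n v (sqrt N)). \<bar>\<Sum>i<n. f i * (y i - v i)\<bar> < n * d \<and>
      \<bar>(\<Sum>i<n. (y i - v i)\<^sup>2) - real n * (sqrt N)\<^sup>2\<bar> < n * d}"
    using gauss_typical[OF s d, of "e/4" "P + d + 1"] e by auto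
  show ?thesis
  proof (intro exI[of _ "max n1 n2"] conjI allI impI)
    show "0 < max n1 n2" using n1 by simp
  next
    fix n M :: nat
    assume n: "max n1 n2 \<le> n" and M: "0 < M"
      and rate: "M * exp (- real n * (C - d * (2 / (P + N) + 1 / (2 * N)))) < e / 4"
    have n_pos: "real n > 0" using n n1 by simp
    let ?B = "PiM {..<n} (\<lambda>_. borel :: real measure)"
    let ?zero = "\<lambda>_::nat. 0 :: real"
    define F where "F = {y \<in> space ?B. \<bar>\<Sum>i<n. y i\<bar> < n * d \<and> \<bar>(\<Sum>i<n. (y i)\<^sup>2) - real n * P\<bar> < n * d}"
    define G where "G c = {y \<in> space ?B. \<bar>\<Sum>i<n. c i * (y i - c i)\<bar> < n * d \<and>
      \<bar>\<Sum>i<n. (y i - c i)\<bar> < n * d \<and> \<bar>(\<Sum>i<n. (y i - c i)\<^sup>2) - real n * N\<bar> < n * d}" for c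
    have F: "F \<in> sets ?B" unfolding F_def by measurable
    have G: "G c \<in> sets ?B" for c unfolding G_def by measurable
    have half: "measure (gauss n ?zero (sqrt P)) F \<ge> 1/2"
      using typ_prior[of n "\<lambda>_. 1" ?zero] n P by (simp add: F_def space_gauss)
    have typical: "measure (gauss n c (sqrt N)) (G c) \<ge> 1 - e/2" if c: "c \<in> F" for c
    proof -
      interpret prob_space "gauss n c (sqrt N)" by (rule prob_space_gauss[OF s])
      let ?A1 = "{y \<in> space (gauss n c (sqrt N)). \<bar>\<Sum>i<n. c i * (y i - c i)\<bar> < n * d \<and>
        \<bar>(\<Sum>i<n. (y i - c i)\<^sup>2) - real n * (sqrt N)\<^sup>2\<bar> < n * d}"
      let ?A2 = "{y \<in> space (gauss n c (sqrt N)). \<bar>\<Sum>i<n. 1 * (y i - c i)\<bar> < n * d \<and>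
        \<bar>(\<Sum>i<n. (y i - c i)\<^sup>2) - real n * (sqrt N)\<^sup>2\<bar> < n * d}"
      have ev: "?A1 \<in> events" "?A2 \<in> events" by (simp_all add: gauss_def)
      have "(\<Sum>i<n. (c i)\<^sup>2) \<le> n * (P + d + 1)"
        using c n_pos unfolding F_def by (auto simp: algebra_simps)
      then have p1: "prob ?A1 \<ge> 1 - e/4" using typ_noise[of n c c] n by simp
      have p2: "prob ?A2 \<ge> 1 - e/4"
        using typ_noise[of n "\<lambda>_. 1" c] n n_pos P d by (simp add: algebra_simps)
      have "1 - prob (?A1 \<inter> ?A2) = prob (space (gauss n c (sqrt N)) - ?A1 \<inter> ?A2)"
        using ev by (intro prob_compl[symmetric]) auto
      also have "\<dots> = prob ((space (gauss n c (sqrt N)) - ?A1) \<union> (space (gauss n c (sqrt N)) - ?A2))"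
        by (intro arg_cong[where f=prob]) auto
      also have "\<dots> \<le> prob (space (gauss n c (sqrt N)) - ?A1) + prob (space (gauss n c (sqrt N)) - ?A2)"
        using ev by (intro measure_Un_le) auto
      also have "\<dots> \<le> e / 4 + e / 4"
        using p1 p2 prob_compl[OF ev(1)] prob_compl[OF ev(2)] by linarith
      finally have "prob (?A1 \<inter> ?A2) \<ge> 1 - e/2" by simp
      moreover have "?A1 \<inter> ?A2 = G c" using N by (auto simp: G_def space_gauss)
      ultimately show ?thesis by simp
    qed
    have tP: "sqrt ((sqrt P)\<^sup>2 + (sqrt N)\<^sup>2) = sqrt (P + N)" using N P by simp
    define g where "g = exp (- real n * (C - d * (2 / (P + N) + 1 / (2 * N))))"
    \<comment> \<open>With \<open>u = 0\<close> this gives the energy of the output, with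
      \<open>u = b\<close> its squared distance to the red alert codeword.\<close>
    have expand: "(\<Sum>i<n. (y i + u)\<^sup>2) = (\<Sum>i<n. (y i - c i)\<^sup>2) + 2 * (\<Sum>i<n. c i * (y i - c i))
        + 2 * u * (\<Sum>i<n. (y i - c i)) + (\<Sum>i<n. (c i)\<^sup>2) + 2 * u * (\<Sum>i<n. c i) + n * u\<^sup>2"
      for y c :: "nat \<Rightarrow> real" and u :: real
    proof -
      have "(\<Sum>i<n. (y i + u)\<^sup>2) = (\<Sum>i<n. (y i - c i)\<^sup>2 + 2 * (c i * (y i - c i)) + 2 * u * (y i - c i) + (c i)\<^sup>2 + 2 * u * c i + u\<^sup>2)"
        by (intro sum.cong refl) (simp add: power2_eq_square algebra_simps)
      then show ?thesis by (simp add: sum.distrib sum_distrib_left)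
    qed
    have small: "measure (gauss n ?zero (sqrt ((sqrt P)\<^sup>2 + (sqrt N)\<^sup>2))) (G c) \<le> g" if c: "c \<in> F" for c
    proof -
      interpret prob_space "gauss n c (sqrt N)" by (rule prob_space_gauss[OF s])
      have "measure (gauss n ?zero (sqrt (P + N))) (G c) \<le> g * prob (G c)"
        unfolding g_def
      proof (rule gauss_change_of_measure)
        fix y assume y: "y \<in> G c"
        \<comment> \<open>The loss \<open>4 * d\<close> is one \<open>d\<close> for the noise
          energy, one for the codeword energy and two for the doubled cross term.\<close>
        have "(\<Sum>i<n. (y i)\<^sup>2) \<ge> n * (P + N - 4 * d)"
          using expand[of y 0 c] y c unfolding G_def F_def by (auto simp: algebra_simps)
        then have "(\<Sum>i<n. (y i)\<^sup>2) / (2 * (P + N)) \<ge> n * (P + N - 4 * d) / (2 * (P + N))"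
          using P N by (intro divide_right_mono) auto
        also have "n * (P + N - 4 * d) / (2 * (P + N)) = n / 2 - real n * d * (2 / (P + N))"
          using P N by (simp add: field_simps)
        finally have 1: "(\<Sum>i<n. (y i)\<^sup>2) / (2 * (P + N)) \<ge> n / 2 - real n * d * (2 / (P + N))" .
        have "(\<Sum>i<n. (y i - c i)\<^sup>2) / (2 * N) \<le> n * (N + d) / (2 * N)"
          using y N unfolding G_def by (intro divide_right_mono) (auto simp: algebra_simps)
        also have "\<dots> = n / 2 + n * d * (1 / (2 * N))" using N by (simp add: field_simps)
        finally have 2: "(\<Sum>i<n. (y i - c i)\<^sup>2) / (2 * N) \<le> n / 2 + n * d * (1 / (2 * N))" .
        have "1 + P / N = (P + N) / N" using N by (simp add: field_simps)
        then have "C = (ln (P + N) - ln N) / 2" using P N by (simp add: C_def ln_div)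
        then have "ln (sqrt (P + N)) - ln (sqrt N) = C" using P N by (simp add: ln_sqrt diff_divide_distrib)
        then have 3: "n * ln (sqrt (P + N)) - real n * ln (sqrt N) = n * C"
          by (metis right_diff_distrib)
        have split: "- real n * (C - d * (2 / (P + N) + 1 / (2 * N))) =
            - (n * C) + n * d * (2 / (P + N)) + n * d * (1 / (2 * N))"
          by (simp add: algebra_simps)
        have sq: "(sqrt (P + N))\<^sup>2 = P + N" "(sqrt N)\<^sup>2 = N" using P N by simp_all
        show "- real n * ln (sqrt (P + N)) - (\<Sum>i<n. (y i - 0)\<^sup>2) / (2 * (sqrt (P + N))\<^sup>2) \<le>
          - real n * (C - d * (2 / (P + N) + 1 / (2 * N))) - real n * ln (sqrt N) - (\<Sum>i<n. (y i - c i)\<^sup>2) / (2 * (sqrt N)\<^sup>2)"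
          unfolding sq diff_zero split using 1 2 3 by linarith
      qed (use P N s G in auto)
      also have "\<dots> \<le> g * 1" by (intro mult_left_mono) (auto simp: g_def)
      finally show ?thesis unfolding tP by simp
    qed
    have Mg: "M * g < e / 4" and g: "g \<ge> 0" using rate by (simp_all add: g_def)
    obtain c A where disj: "disjoint_family_on A {1..M}"
      and cA: "\<And>w. w \<in> {1..M} \<Longrightarrow> c w \<in> F \<and> A w \<in> sets ?B \<and> A w \<subseteq> G (c w) \<and>
        measure (gauss n (c w) (sqrt N)) (A w) \<ge> 1 - e"
      using feinstein[OF r s F half G typical small e(1) Mg g] by blast
    \<comment> \<open>The maximal code uses only the indices \<open>1..M\<close>, so index 0 is free
      for the red alert codeword.\<close>
    define c' where "c' = c(0 := (\<lambda>_. - b))"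
    have c'w: "c' w = c w" if "w \<in> {1..M}" for w using that by (auto simp: c'_def)
    define q where "q = exp (- real n * ((P + b\<^sup>2 - d * (3 + 4 * b)) / (2 * N)))"
    have alert: "measure (gauss n (c' 0) (sqrt N)) (A w) \<le> q" if w: "w \<in> {1..M}" for w
    proof -
      interpret prob_space "gauss n (c w) (sqrt N)" by (rule prob_space_gauss[OF s])
      have "measure (gauss n (c' 0) (sqrt N)) (A w) \<le> q * prob (A w)"
        unfolding q_def
      proof (rule gauss_change_of_measure)
        fix y assume "y \<in> A w"
        then have y: "y \<in> G (c w)" and c: "c w \<in> F" using cA[OF w] by auto
        have "2 * b * (\<Sum>i<n. (y i - c w i)) \<ge> 2 * b * (- (n * d))" "2 * b * (\<Sum>i<n. c w i) \<ge> 2 * b * (- (n * d))"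
          using y c b unfolding G_def F_def by (intro mult_left_mono; simp add: abs_less_iff)+
        \<comment> \<open>In the loss, \<open>3 * d\<close> comes from the codeword energy and the
          doubled cross term; the two sums along the all-ones vector, each weighted by
          \<open>2 * b\<close>, add \<open>4 * b * d\<close>.\<close>
        then have "(\<Sum>i<n. (y i + b)\<^sup>2) \<ge> (\<Sum>i<n. (y i - c w i)\<^sup>2) + n * (P + b\<^sup>2 - d * (3 + 4 * b))"
          using expand[of y b "c w"] y c unfolding G_def F_def by (auto simp: algebra_simps)
        then have "(\<Sum>i<n. (y i + b)\<^sup>2) / (2 * N) \<ge> ((\<Sum>i<n. (y i - c w i)\<^sup>2) + n * (P + b\<^sup>2 - d * (3 + 4 * b))) / (2 * N)"
          using N by (intro divide_right_mono) auto
        then show "- real n * ln (sqrt N) - (\<Sum>i<n. (y i - c' 0 i)\<^sup>2) / (2 * (sqrt N)\<^sup>2) \<le>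
          - real n * ((P + b\<^sup>2 - d * (3 + 4 * b)) / (2 * N)) - real n * ln (sqrt N) - (\<Sum>i<n. (y i - c w i)\<^sup>2) / (2 * (sqrt N)\<^sup>2)"
          using N by (simp add: c'_def add_divide_distrib)
      qed (use s cA[OF w] in auto)
      also have "\<dots> \<le> q * 1" by (intro mult_left_mono) (auto simp: q_def)
      finally show ?thesis by simp
    qed
    have "\<exists>D. D \<in> ?B \<rightarrow>\<^sub>M count_space UNIV \<and> (\<forall>y. D y \<le> M) \<and>
      p_MD N n c' D \<le> M * q \<and> p_FA N n M c' D \<le> e \<and> p_MSG N n M c' D \<le> e / (1 - e)"
      by (rule decoder_from_sets[OF N disj]) (use cA c'w alert e M in auto)
    then obtain D where D: "D \<in> ?B \<rightarrow>\<^sub>M count_space UNIV" "\<forall>y. D y \<le> M"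
      "p_MD N n c' D \<le> M * q" "p_FA N n M c' D \<le> e" "p_MSG N n M c' D \<le> e / (1 - e)" by blast
    show "\<exists>c D. D \<in> ?B \<rightarrow>\<^sub>M count_space UNIV \<and> (\<forall>y. D y \<le> M) \<and> c 0 = (\<lambda>_. - b) \<and>
      (\<forall>w\<in>{1..M}. \<bar>\<Sum>i<n. c w i\<bar> < n * d \<and> \<bar>(\<Sum>i<n. (c w i)\<^sup>2) - real n * P\<bar> < n * d) \<and>
      p_MD N n c D \<le> M * exp (- real n * ((P + b\<^sup>2 - d * (3 + 4 * b)) / (2 * N))) \<and>
      p_FA N n M c D \<le> e \<and> p_MSG N n M c D \<le> e / (1 - e)"
    proof (intro exI[of _ c'] exI[of _ D] conjI ballI)
      fix w assume w: "w \<in> {1..M}"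
      then have "c w \<in> F" using cA by auto
      then show "\<bar>\<Sum>i<n. c' w i\<bar> < n * d" "\<bar>(\<Sum>i<n. (c' w i)\<^sup>2) - real n * P\<bar> < n * d"
        unfolding c'w[OF w] F_def by auto
    qed (use D in \<open>auto simp: c'_def q_def\<close>)
  qed
qed

section \<open>Parameters for the achievability bound\<close>

lemma exp_decay_below:
  fixes g c :: real
  assumes "g > 0" "c > 0"
  obtains n0 :: nat where "\<And>n. n \<ge> n0 \<Longrightarrow> exp (- real n * g) < c"
proof -
  obtain n0 :: nat where n0: "real n0 > - ln c / g" using reals_Archimedean2 by blast
  have "exp (- real n * g) < c" if "n \<ge> n0" for n
  proof -
    have "- ln c / g < real n" using n0 that by linarith
    then have "- real n * g < ln c" using assms(1) by (simp add: field_simps)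
    then have "exp (- real n * g) < exp (ln c)" by simp
    then show ?thesis using assms(2) by simp
  qed
  then show thesis by (rule that)
qed

text \<open>Since \<open>exp (n * R)\<close> is at least 1, rounding changes it by at most a factor
  of two, which is harmless on the exponential scale.\<close>

lemma num_msgs_bounds:
  assumes "R \<ge> 0"
  shows "num_msgs R n > 0" "real (num_msgs R n) \<le> 2 * exp (n * R)" "exp (n * R) / 2 \<le> real (num_msgs R n)"
proof -
  let ?x = "exp (n * R)"
  have x: "?x \<ge> 1" using assms by simp
  have lo: "real_of_int (round ?x) \<ge> ?x - 1/2" and hi: "real_of_int (round ?x) \<le> ?x + 1/2"
    by (rule of_int_round_ge, rule of_int_round_le)
  then have pos: "round ?x > 0" using x by linarith
  then have eq: "real (num_msgs R n) = real_of_int (round ?x)" by (simp add: num_msgs_def)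
  show "num_msgs R n > 0" using pos by (simp add: num_msgs_def)
  show "real (num_msgs R n) \<le> 2 * ?x" "?x / 2 \<le> real (num_msgs R n)" unfolding eq using lo hi x by linarith+
qed

lemma achievable_red_alert_exponent:
  fixes N Pavg Palert R :: real
  assumes N: "N > 0" and Pavg: "Pavg > 0" and PP: "Palert \<ge> Pavg"
    and R: "0 \<le> R" "R < (1/2) * ln (1 + Pavg / N)"
  shows "achievable_exponent N Pavg Palert R
    ((Palert + Pavg + 2 * sqrt (Palert * (Pavg + N * (1 - exp (2 * R))))) / (2 * N) - R)"
    (is "achievable_exponent _ _ _ _ ?E")
  unfolding achievable_exponent_def
proof (intro allI impI)
  fix \<epsilon> :: real assume \<epsilon>: "\<epsilon> > 0"
  define Pm where "Pm = N * (exp (2 * R) - 1)"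
  define Pb where "Pb = Pavg - Pm"
  have Pm: "Pm \<ge> 0" unfolding Pm_def using N R by simp
  have "exp (2 * R) < exp (ln (1 + Pavg / N))" using R(2) by simp
  also have "\<dots> = 1 + Pavg / N" using N Pavg by (simp add: add_pos_pos)
  finally have Pb: "Pb > 0" unfolding Pb_def Pm_def using N by (simp add: field_simps)
  have E: "?E + R = (Pm + (sqrt Palert + sqrt Pb)\<^sup>2) / (2 * N)"
  proof -
    have "Pavg + N * (1 - exp (2 * R)) = Pb" by (simp add: Pb_def Pm_def algebra_simps)
    then show ?thesis using Pb Pavg PP
      by (simp add: power2_sum real_sqrt_mult Pb_def)
  qed
  \<comment> \<open>The exponent, before subtracting \<open>R\<close>, when the code gets power
    \<open>Pm + t\<close>, enough for a rate above \<open>R\<close>, and the offset gets power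
    \<open>Pb - 2 * t\<close>. The remaining \<open>t\<close> absorbs deviations in the power
    constraint. As \<open>t\<close> tends to 0 from the right nothing is lost.\<close>
  define h where "h t = (Pm + t + (sqrt Palert + sqrt (Pb - 2 * t))\<^sup>2) / (2 * N)" for t
  have "(h \<longlongrightarrow> (Pm + 0 + (sqrt Palert + sqrt (Pb - 2 * 0))\<^sup>2) / (2 * N)) (at_right 0)"
    unfolding h_def using N by (intro tendsto_intros) auto
  then have "(h \<longlongrightarrow> ?E + R) (at_right 0)" unfolding E by simp
  then have "\<forall>\<^sub>F t in at_right 0. h t > ?E + R - \<epsilon> / 3"
    by (rule order_tendstoD) (use \<epsilon> in simp)
  moreover have "\<forall>\<^sub>F t in at_right 0. t \<in> {0<..<Pb / 2}"
    using Pb by (intro eventually_at_right_real) simp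
  ultimately have "\<forall>\<^sub>F t in at_right 0. h t > ?E + R - \<epsilon> / 3 \<and> t \<in> {0<..<Pb / 2}"
    by (rule eventually_conj)
  then obtain t where ht: "h t > ?E + R - \<epsilon> / 3" and t: "0 < t" "t < Pb / 2"
    using eventually_happens'[of "at_right (0::real)"] by fastforce
  define P where "P = Pm + t"
  define a where "a = sqrt (Pb - 2 * t)"
  define b where "b = sqrt Palert + a"
  have P: "P > 0" using Pm t by (simp add: P_def)
  have a: "a \<ge> 0" "a\<^sup>2 = Pb - 2 * t" using t by (simp_all add: a_def)
  have b: "b \<ge> 0" using a Pavg PP by (simp add: b_def)
  have hb: "h t = (P + b\<^sup>2) / (2 * N)" by (simp add: h_def P_def b_def a_def)
  define C where "C = ln (1 + P / N) / 2"
  have CR: "C > R"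
  proof -
    have "1 + P / N > exp (2 * R)" using N t by (simp add: P_def Pm_def field_simps)
    then have "ln (1 + P / N) > ln (exp (2 * R))" using P N by (subst ln_less_cancel_iff) (auto simp: add_pos_pos)
    then show ?thesis by (simp add: C_def)
  qed
  define g where "g = (C - R) / 2"
  have g: "g > 0" using CR by (simp add: g_def)
  define k where "k = 2 / (P + N) + 1 / (2 * N)"
  have k: "k > 0" using P N by (simp add: k_def add_pos_pos)
  \<comment> \<open>The three bounds on \<open>d\<close> secure, in turn, the average power
    constraint, a rate margin \<open>g\<close> below capacity, and a loss of at most
    \<open>\<epsilon> / 3\<close> in the exponent.\<close>
  define d where "d = min (t / (2 * a + 1)) (min (g / k) (\<epsilon> / 3 * (2 * N) / (3 + 4 * b)))"
  have d: "d > 0" using t a g k \<epsilon> N b by (simp add: d_def add_nonneg_pos)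
  have "d \<le> t / (2 * a + 1)" "d \<le> g / k" "d \<le> \<epsilon> / 3 * (2 * N) / (3 + 4 * b)"
    by (simp_all add: d_def)
  then have d1: "d * (2 * a + 1) \<le> t" and d2: "d * k \<le> g" and d3: "d * (3 + 4 * b) / (2 * N) \<le> \<epsilon> / 3"
    using a k b N by (simp_all add: pos_le_divide_eq divide_le_eq add_nonneg_pos algebra_simps)
  define e where "e = min (1/2) (\<epsilon> / 3)"
  have e: "0 < e" "e < 1" "e < \<epsilon>" using \<epsilon> by (auto simp: e_def)
  have e2: "e / (1 - e) < \<epsilon>"
  proof -
    have "e \<le> \<epsilon> / 3" by (simp add: e_def)
    moreover have "\<epsilon> * e \<le> \<epsilon> * (1/2)" using \<epsilon> by (intro mult_left_mono) (auto simp: e_def)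
    ultimately have "e + \<epsilon> * e < \<epsilon>" using \<epsilon> by linarith
    then have "e < \<epsilon> * (1 - e)" by (simp add: algebra_simps)
    then show ?thesis using e by (simp add: pos_divide_less_eq)
  qed
  obtain n0 where n0: "n0 > 0" and code: "\<forall>n\<ge>n0. \<forall>M>0. M * exp (- real n * (C - d * k)) < e / 4 \<longrightarrow>
    (\<exists>c D. D \<in> PiM {..<n} (\<lambda>_. borel) \<rightarrow>\<^sub>M count_space UNIV \<and> (\<forall>y. D y \<le> M) \<and> c 0 = (\<lambda>_. - b) \<and>
      (\<forall>w\<in>{1..M}. \<bar>\<Sum>i<n. c w i\<bar> < n * d \<and> \<bar>(\<Sum>i<n. (c w i)\<^sup>2) - real n * P\<bar> < n * d) \<and>
      p_MD N n c D \<le> M * exp (- real n * ((P + b\<^sup>2 - d * (3 + 4 * b)) / (2 * N))) \<and>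
      p_FA N n M c D \<le> e \<and> p_MSG N n M c D \<le> e / (1 - e))"
    using red_alert_code_exists[OF N P b d e(1,2), folded C_def k_def] by (elim exE conjE)
  obtain n1 where n1: "\<And>n. n \<ge> n1 \<Longrightarrow> exp (- real n * g) < e / 8"
    using exp_decay_below[OF g, of "e / 8"] e by auto
  obtain n2 where n2: "\<And>n. n \<ge> n2 \<Longrightarrow> exp (- real n * (\<epsilon> / 3)) < 1 / 2"
    using exp_decay_below[of "\<epsilon> / 3" "1/2"] \<epsilon> by auto
  show "\<exists>n0. \<forall>n\<ge>n0. \<exists>x D. valid_code Pavg Palert n (num_msgs R n) x D \<and>
    p_MD N n x D < exp (- real n * (?E - \<epsilon>)) \<and> p_FA N n (num_msgs R n) x D < \<epsilon> \<and> p_MSG N n (num_msgs R n) x D < \<epsilon>"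
  proof (intro exI[of _ "max n0 (max n1 n2)"] allI impI)
    fix n assume "max n0 (max n1 n2) \<le> n"
    then have n: "n \<ge> n0" "n \<ge> n1" "n \<ge> n2" by auto
    define M where "M = num_msgs R n"
    have M: "M > 0" "real M \<le> 2 * exp (n * R)" using num_msgs_bounds[OF R(1)] by (auto simp: M_def)
    have "M * exp (- real n * (C - d * k)) \<le> (2 * exp (n * R)) * exp (- real n * (R + g))"
    proof (intro mult_mono M)
      have "R + g \<le> C - d * k" using d2 by (simp add: g_def field_simps)
      then show "exp (- real n * (C - d * k)) \<le> exp (- real n * (R + g))" by (simp add: mult_left_mono)
    qed auto
    also have "\<dots> = 2 * exp (- real n * g)" by (simp add: mult_exp_exp algebra_simps)
    also have "\<dots> < e / 4" using n1[OF n(2)] by simp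
    finally obtain c D where D: "D \<in> PiM {..<n} (\<lambda>_. borel) \<rightarrow>\<^sub>M count_space UNIV" "\<And>y. D y \<le> M"
      and c0: "c 0 = (\<lambda>_. - b)"
      and c: "\<And>w. w \<in> {1..M} \<Longrightarrow> \<bar>\<Sum>i<n. c w i\<bar> < n * d \<and> \<bar>(\<Sum>i<n. (c w i)\<^sup>2) - real n * P\<bar> < n * d"
      and MD: "p_MD N n c D \<le> M * exp (- real n * ((P + b\<^sup>2 - d * (3 + 4 * b)) / (2 * N)))"
      and FA: "p_FA N n M c D \<le> e" and MSG: "p_MSG N n M c D \<le> e / (1 - e)"
      using code[rule_format, OF n(1) M(1)] by blast
    \<comment> \<open>Since \<open>b = sqrt Palert + a\<close>, the shift by \<open>a\<close> moves
      the red alert codeword to \<open>- sqrt Palert\<close> in every coordinate, which uses its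
      full power.\<close>
    define x where "x w i = a + c w i" for w i
    define D' where "D' y = D (\<lambda>i\<in>{..<n}. y i - a)" for y
    have out: "out_prob N n x D' = out_prob N n c D"
      unfolding x_def[abs_def] D'_def[abs_def] by (rule out_prob_translate)
    have power: "(\<Sum>i<n. (x w i)\<^sup>2) \<le> n * Pavg" if w: "w \<in> {1..M}" for w
    proof -
      have "(\<Sum>i<n. (x w i)\<^sup>2) = n * a\<^sup>2 + 2 * a * (\<Sum>i<n. c w i) + (\<Sum>i<n. (c w i)\<^sup>2)"
        by (simp add: x_def power2_sum sum.distrib sum_distrib_left)
      also have "\<dots> \<le> n * a\<^sup>2 + 2 * a * (n * d) + (n * P + n * d)"
        using c[OF w] a(1) by (intro add_mono mult_left_mono) auto
      also have "\<dots> = n * (a\<^sup>2 + P + d * (2 * a + 1))" by (simp add: algebra_simps)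
      also have "\<dots> \<le> n * Pavg"
        using d1 a(2) by (intro mult_left_mono) (auto simp: P_def Pb_def)
      finally show ?thesis .
    qed
    have "(1 / real M) * (\<Sum>w\<in>{1..M}. \<Sum>i<n. (x w i)\<^sup>2) \<le> n * Pavg"
      using sum_mono[of "{1..M}" "\<lambda>w. \<Sum>i<n. (x w i)\<^sup>2" "\<lambda>_. n * Pavg", OF power] M(1)
      by (simp add: field_simps)
    moreover have "(\<Sum>i<n. (x 0 i)\<^sup>2) \<le> n * Palert"
      using Pavg PP by (simp add: x_def c0 b_def)
    ultimately have valid: "valid_code Pavg Palert n M x D'"
      using D measurable_translate[OF D(1), of a] by (simp add: valid_code_def D'_def[abs_def])
    have "p_MD N n c D \<le> (2 * exp (n * R)) * exp (- real n * ((P + b\<^sup>2 - d * (3 + 4 * b)) / (2 * N)))"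
      using MD M(2) by (meson exp_ge_zero mult_right_mono order_trans)
    \<comment> \<open>The factor 2 from rounding consumes one third of \<open>\<epsilon>\<close>;
      the other two thirds go to \<open>t\<close> and to \<open>d\<close>.\<close>
    also have "\<dots> < (exp (n * (\<epsilon> / 3)) * exp (n * R)) * exp (- real n * ((P + b\<^sup>2 - d * (3 + 4 * b)) / (2 * N)))"
      using n2[OF n(3)] by (simp add: exp_minus field_simps)
    also have "\<dots> = exp (- real n * ((P + b\<^sup>2) / (2 * N) - R - d * (3 + 4 * b) / (2 * N) - \<epsilon> / 3))"
      by (simp add: mult_exp_exp diff_divide_distrib algebra_simps)
    also have "\<dots> \<le> exp (- real n * (?E - \<epsilon>))"
      using ht[unfolded hb] d3 by (simp add: mult_left_mono)
    finally have "p_MD N n x D' < exp (- real n * (?E - \<epsilon>))"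
      by (simp add: p_MD_def out)
    moreover have "p_FA N n M x D' < \<epsilon>" "p_MSG N n M x D' < \<epsilon>"
      using FA MSG e(3) e2 by (simp_all add: p_FA_def p_MSG_def out)
    ultimately show "\<exists>x D. valid_code Pavg Palert n (num_msgs R n) x D \<and>
      p_MD N n x D < exp (- real n * (?E - \<epsilon>)) \<and> p_FA N n (num_msgs R n) x D < \<epsilon> \<and> p_MSG N n (num_msgs R n) x D < \<epsilon>"
      using valid unfolding M_def by blast
  qed
qed

subsection \<open>Converse\<close>

text \<open>At least \<open>1/2 + 3/4 - 1 = 1/4\<close> of the probability lies in both
  \<open>A\<close> and \<open>T\<close>, and on \<open>T\<close> the density ratio is controlled, so
  the change of measure turns this mass into a lower bound under the other Gaussian.\<close>

lemma gauss_lower_change_of_measure: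
  assumes s: "s > 0" and t: "t > 0" and A: "A \<in> sets (PiM {..<n} (\<lambda>_. borel))"
    and T: "T \<in> sets (PiM {..<n} (\<lambda>_. borel))"
    and likely: "measure (gauss n v s) A \<ge> 1/2" and typical: "measure (gauss n v s) T \<ge> 3/4"
    and le: "\<And>y. y \<in> T \<Longrightarrow> - real n * ln s - (\<Sum>i<n. (y i - v i)\<^sup>2) / (2 * s\<^sup>2)
      \<le> k - real n * ln t - (\<Sum>i<n. (y i - u i)\<^sup>2) / (2 * t\<^sup>2)"
  shows "measure (gauss n u t) A \<ge> exp (- k) / 4"
proof -
  interpret V: prob_space "gauss n v s" by (rule prob_space_gauss[OF s])
  interpret U: prob_space "gauss n u t" by (rule prob_space_gauss[OF t])
  have ev: "A \<in> V.events" "T \<in> V.events" "A \<inter> T \<in> V.events" using A T by (auto simp: sets_gauss)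
  have "V.prob A \<le> V.prob ((A \<inter> T) \<union> (space (gauss n v s) - T))"
    using ev sets.sets_into_space[OF ev(1)] by (intro V.finite_measure_mono) auto
  also have "\<dots> \<le> V.prob (A \<inter> T) + V.prob (space (gauss n v s) - T)"
    using ev by (intro measure_Un_le) auto
  finally have "V.prob (A \<inter> T) \<ge> 1/4"
    using likely typical V.prob_compl[OF ev(2)] by simp
  also have "V.prob (A \<inter> T) \<le> exp k * U.prob (A \<inter> T)"
    using ev le by (intro gauss_change_of_measure[OF s t]) (auto simp: sets_gauss)
  also have "\<dots> \<le> exp k * U.prob A"
    using A by (intro mult_left_mono U.finite_measure_mono) (auto simp: sets_gauss)
  finally show ?thesis by (simp add: exp_minus field_simps)
qed

lemma sum_square_shift:
  "(\<Sum>i<n. (y i - u i)\<^sup>2) = (\<Sum>i<n. (y i - v i)\<^sup>2) + 2 * (\<Sum>i<n. (v i - u i) * (y i - v i)) + (\<Sum>i<n. (v i - u i)\<^sup>2)"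
  for y u v :: "nat \<Rightarrow> real"
proof -
  have "(\<Sum>i<n. (y i - u i)\<^sup>2) = (\<Sum>i<n. (y i - v i)\<^sup>2 + 2 * ((v i - u i) * (y i - v i)) + (v i - u i)\<^sup>2)"
    by (intro sum.cong refl) (simp add: power2_eq_square algebra_simps)
  then show ?thesis by (simp add: sum.distrib sum_distrib_left)
qed

text \<open>Reliable decoding of a codeword at squared distance at most \<open>n * K\<close> from
  the red alert codeword \<open>u\<close> forces its decoding set to catch a red alert with this
  probability. The typicality level \<open>N * d\<close> becomes \<open>d\<close> after division by
  \<open>2 * N\<close>, because the cross term is doubled.\<close>

lemma gauss_detection_lower_bound:
  assumes N: "N > 0" and d: "d > 0"
  shows "\<exists>n0. \<forall>n\<ge>n0. \<forall>v u A. A \<in> sets (PiM {..<n} (\<lambda>_. borel)) \<longrightarrow> (\<Sum>i<n. (v i - u i)\<^sup>2) \<le> n * K \<longrightarrow>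
    measure (gauss n v (sqrt N)) A \<ge> 1/2 \<longrightarrow> measure (gauss n u (sqrt N)) A \<ge> exp (- real n * (K / (2 * N) + d)) / 4"
proof -
  have s: "sqrt N > 0" and Nd: "N * d > 0" using N d by auto
  obtain n0 where noise: "\<And>n v (b :: nat \<Rightarrow> real). n \<ge> n0 \<Longrightarrow> (\<Sum>i<n. (b i)\<^sup>2) \<le> n * K \<Longrightarrow>
    1 - 1/4 \<le> measure (gauss n v (sqrt N)) {y \<in> space (gauss n v (sqrt N)). \<bar>\<Sum>i<n. b i * (y i - v i)\<bar> < n * (N * d) \<and>
      \<bar>(\<Sum>i<n. (y i - v i)\<^sup>2) - n * (sqrt N)\<^sup>2\<bar> < n * (N * d)}"
    using gauss_typical[OF s Nd, of "1/4" K] by auto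
  show ?thesis
  proof (intro exI[of _ n0] allI impI)
    fix n :: nat and v u :: "nat \<Rightarrow> real" and A
    assume n: "n0 \<le> n" and A: "A \<in> sets (PiM {..<n} (\<lambda>_. borel))" and K: "(\<Sum>i<n. (v i - u i)\<^sup>2) \<le> n * K"
      and half: "1/2 \<le> measure (gauss n v (sqrt N)) A"
    let ?T = "{y \<in> space (gauss n v (sqrt N)). \<bar>\<Sum>i<n. (v i - u i) * (y i - v i)\<bar> < n * (N * d) \<and>
      \<bar>(\<Sum>i<n. (y i - v i)\<^sup>2) - n * (sqrt N)\<^sup>2\<bar> < n * (N * d)}"
    have "exp (- (n * (K / (2 * N) + d))) / 4 \<le> measure (gauss n u (sqrt N)) A"
    proof (rule gauss_lower_change_of_measure[OF s s A _ half])
      show "?T \<in> sets (PiM {..<n} (\<lambda>_. borel))" unfolding space_gauss by measurable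
      show "3/4 \<le> measure (gauss n v (sqrt N)) ?T" using noise[of n "\<lambda>i. v i - u i" v] n K by simp
      fix y assume y: "y \<in> ?T"
      then have "(\<Sum>i<n. (y i - u i)\<^sup>2) \<le> (\<Sum>i<n. (y i - v i)\<^sup>2) + n * (K + 2 * N * d)"
        using K unfolding sum_square_shift[of y u n v] by (auto simp: algebra_simps)
      then have "(\<Sum>i<n. (y i - u i)\<^sup>2) / (2 * N) \<le> ((\<Sum>i<n. (y i - v i)\<^sup>2) + n * (K + 2 * N * d)) / (2 * N)"
        using N by (intro divide_right_mono) auto
      also have "\<dots> = (\<Sum>i<n. (y i - v i)\<^sup>2) / (2 * N) + n * (K / (2 * N) + d)"
        using N by (simp add: field_simps)
      finally show "- real n * ln (sqrt N) - (\<Sum>i<n. (y i - v i)\<^sup>2) / (2 * (sqrt N)\<^sup>2)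
        \<le> n * (K / (2 * N) + d) - real n * ln (sqrt N) - (\<Sum>i<n. (y i - u i)\<^sup>2) / (2 * (sqrt N)\<^sup>2)"
        using N by simp
    qed
    then show "exp (- real n * (K / (2 * N) + d)) / 4 \<le> measure (gauss n u (sqrt N)) A" by simp
  qed
qed

text \<open>Under the Gaussian measure with centre \<open>m\<close> and variance \<open>P + N\<close>, each decoding set has
  probability at least about \<open>exp (- n C)\<close>, and the decoding sets are disjoint.\<close>

lemma gauss_packing_bound:
  assumes N: "N > 0" and P: "P > 0" and d: "d > 0"
  shows "\<exists>n0. \<forall>n\<ge>n0. \<forall>m x A (W :: nat set). finite W \<longrightarrow> disjoint_family_on A W \<longrightarrow>
    (\<forall>w\<in>W. A w \<in> sets (PiM {..<n} (\<lambda>_. borel)) \<and> (\<Sum>i<n. (x w i - m i)\<^sup>2) \<le> n * P \<and>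
      measure (gauss n (x w) (sqrt N)) (A w) \<ge> 1/2) \<longrightarrow>
    card W \<le> 4 * exp (n * (ln (1 + P / N) / 2 + d))"
proof -
  define C where "C = ln (1 + P / N) / 2"
  have s: "sqrt N > 0" and t: "sqrt (P + N) > 0" and Nd: "N * d / 2 > 0" using N P d by auto
  obtain n0 where noise: "\<And>n v (b :: nat \<Rightarrow> real). n \<ge> n0 \<Longrightarrow> (\<Sum>i<n. (b i)\<^sup>2) \<le> n * P \<Longrightarrow>
    1 - 1/4 \<le> measure (gauss n v (sqrt N)) {y \<in> space (gauss n v (sqrt N)). \<bar>\<Sum>i<n. b i * (y i - v i)\<bar> < n * (N * d / 2) \<and>
      \<bar>(\<Sum>i<n. (y i - v i)\<^sup>2) - n * (sqrt N)\<^sup>2\<bar> < n * (N * d / 2)}"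
    using gauss_typical[OF s Nd, of "1/4" P] by auto
  have "1 + P / N = (P + N) / N" using N by (simp add: field_simps)
  then have "C = (ln (P + N) - ln N) / 2" using P N by (simp add: C_def ln_div)
  then have lnC: "ln (sqrt (P + N)) - ln (sqrt N) = C" using P N by (simp add: ln_sqrt diff_divide_distrib)
  have lower: "exp (- (n * (C + d))) / 4 \<le> measure (gauss n m (sqrt (P + N))) A"
    if n: "n0 \<le> n" and A: "A \<in> sets (PiM {..<n} (\<lambda>_. borel))" and K: "(\<Sum>i<n. (v i - m i)\<^sup>2) \<le> n * P"
      and half: "1/2 \<le> measure (gauss n v (sqrt N)) A" for n v m A
  proof -
    let ?T = "{y \<in> space (gauss n v (sqrt N)). \<bar>\<Sum>i<n. (v i - m i) * (y i - v i)\<bar> < n * (N * d / 2) \<and>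
      \<bar>(\<Sum>i<n. (y i - v i)\<^sup>2) - n * (sqrt N)\<^sup>2\<bar> < n * (N * d / 2)}"
    show ?thesis
    proof (rule gauss_lower_change_of_measure[OF s t A _ half])
      show "?T \<in> sets (PiM {..<n} (\<lambda>_. borel))" unfolding space_gauss by measurable
      show "3/4 \<le> measure (gauss n v (sqrt N)) ?T" using noise[of n "\<lambda>i. v i - m i" v] n K by simp
      fix y assume y: "y \<in> ?T"
      define Z where "Z = (\<Sum>i<n. (y i - v i)\<^sup>2)"
      have Y: "(\<Sum>i<n. (y i - m i)\<^sup>2) \<le> Z + n * (P + N * d)"
        using K y unfolding sum_square_shift[of y m n v] Z_def by (auto simp: algebra_simps)
      have Z: "Z \<ge> n * (N - N * d / 2)"
      proof -
        have "\<bar>Z - n * N\<bar> < n * (N * d / 2)" using y N by (simp add: Z_def)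
        then show ?thesis unfolding right_diff_distrib by linarith
      qed
      \<comment> \<open>For \<open>Z\<close> equal to \<open>n * N\<close> the two quadratic
        exponents agree to leading order, leaving only \<open>n * C\<close>. The lower bound on
        \<open>Z\<close> limits the deviation, which the margin \<open>n * d\<close>
        absorbs.\<close>
      have "N * (Z + n * (P + N * d)) \<le> (P + N) * Z + n * d * (2 * N * (P + N))"
      proof -
        have "P * (n * (N - N * d / 2)) \<le> P * Z" using Z P by (intro mult_left_mono) auto
        moreover have "n * d * (N * P) \<ge> 0" "n * d * (N * N) \<ge> 0" using N P d by simp_all
        ultimately show ?thesis by (simp add: algebra_simps)
      qed
      then have "(Z + n * (P + N * d)) / (2 * (P + N)) \<le> Z / (2 * N) + n * d"
        using N P by (simp add: field_simps)
      moreover have "(\<Sum>i<n. (y i - m i)\<^sup>2) / (2 * (P + N)) \<le> (Z + n * (P + N * d)) / (2 * (P + N))"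
        using Y N P by (intro divide_right_mono) auto
      moreover have "n * ln (sqrt (P + N)) - n * ln (sqrt N) = n * C" using lnC by (metis right_diff_distrib)
      moreover have "n * (C + d) = n * C + n * d" by (simp add: algebra_simps)
      moreover have "(sqrt (P + N))\<^sup>2 = P + N" "(sqrt N)\<^sup>2 = N" using N P by simp_all
      ultimately show "- real n * ln (sqrt N) - (\<Sum>i<n. (y i - v i)\<^sup>2) / (2 * (sqrt N)\<^sup>2)
        \<le> n * (C + d) - real n * ln (sqrt (P + N)) - (\<Sum>i<n. (y i - m i)\<^sup>2) / (2 * (sqrt (P + N))\<^sup>2)"
        unfolding Z_def by simp
    qed
  qed
  show ?thesis
    unfolding C_def[symmetric]
  proof (intro exI[of _ n0] allI impI)
    fix n :: nat and m :: "nat \<Rightarrow> real" and x :: "nat \<Rightarrow> nat \<Rightarrow> real" and A and W :: "nat set"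
    assume n: "n0 \<le> n" and W: "finite W" and disj: "disjoint_family_on A W"
      and A: "\<forall>w\<in>W. A w \<in> sets (PiM {..<n} (\<lambda>_. borel)) \<and> (\<Sum>i<n. (x w i - m i)\<^sup>2) \<le> n * P \<and>
      measure (gauss n (x w) (sqrt N)) (A w) \<ge> 1/2"
    interpret Q: prob_space "gauss n m (sqrt (P + N))" by (rule prob_space_gauss[OF t])
    have "card W * (exp (- (n * (C + d))) / 4) = (\<Sum>w\<in>W. exp (- (n * (C + d))) / 4)" by simp
    also have "\<dots> \<le> (\<Sum>w\<in>W. Q.prob (A w))" using A by (intro sum_mono lower[OF n]) auto
    also have "\<dots> = Q.prob (\<Union>w\<in>W. A w)"
      using A by (intro Q.finite_measure_finite_Union[symmetric] W disj) (auto simp: sets_gauss)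
    also have "\<dots> \<le> 1" by simp
    finally show "card W \<le> 4 * exp (n * (C + d))"
      by (simp only: exp_minus) (simp add: field_simps del: ring_distribs)
  qed
qed

section \<open>Counting codewords near and far from the red alert codeword\<close>

lemma card_exceeding_le:
  fixes f :: "'a \<Rightarrow> real"
  assumes "finite S" "\<And>w. w \<in> S \<Longrightarrow> f w \<ge> 0" "t > 0" "sum f S \<le> b"
  shows "card {w\<in>S. f w > t} \<le> b / t"
proof -
  have "card {w\<in>S. f w > t} * t = (\<Sum>w\<in>{w\<in>S. f w > t}. t)" by simp
  also have "\<dots> \<le> (\<Sum>w\<in>{w\<in>S. f w > t}. f w)" by (intro sum_mono) auto
  also have "\<dots> \<le> sum f S" using assms by (intro sum_mono2) auto
  finally show ?thesis using assms by (simp add: pos_le_divide_eq)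
qed

text \<open>The identity \<open>|x + b z|^2 = (1 + b) |x|^2 + (b + b^2) |z|^2 - b |x - z|^2\<close>
  shows that a codeword of limited power far from \<open>z\<close> must be close to
  \<open>- b z\<close>.\<close>

lemma far_codeword_in_ball:
  fixes x z :: "nat \<Rightarrow> real"
  assumes x: "(\<Sum>i<n. (x i)\<^sup>2) \<le> n * p" and z: "(\<Sum>i<n. (z i)\<^sup>2) \<le> n * q" and b: "b > 0"
    and far: "(\<Sum>i<n. (x i - z i)\<^sup>2) > n * T"
  shows "(\<Sum>i<n. (x i - (- b * z i))\<^sup>2) < n * ((1 + b) * p + (b + b\<^sup>2) * q - b * T)"
proof -
  define X Y Z where "X = (\<Sum>i<n. (x i)\<^sup>2)" and "Y = (\<Sum>i<n. (z i)\<^sup>2)" and "Z = (\<Sum>i<n. x i * z i)"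
  have "(\<Sum>i<n. (x i - c * z i)\<^sup>2) = X - 2 * c * Z + c\<^sup>2 * Y" for c
  proof -
    have "(\<Sum>i<n. (x i - c * z i)\<^sup>2) = (\<Sum>i<n. (x i)\<^sup>2 - 2 * c * (x i * z i) + c\<^sup>2 * (z i)\<^sup>2)"
      by (intro sum.cong refl) (simp add: power2_eq_square algebra_simps)
    then show ?thesis by (simp add: X_def Y_def Z_def sum.distrib sum_subtractf sum_distrib_left)
  qed
  from this[of 1] this[of "- b"] have 1: "X - 2 * Z + Y > n * T"
    and 2: "(\<Sum>i<n. (x i - (- b * z i))\<^sup>2) = X + 2 * b * Z + b\<^sup>2 * Y" using far by simp_all
  have "b * (n * T) < b * (X - 2 * Z + Y)" using 1 b by simp
  moreover have "(1 + b) * X \<le> (1 + b) * (n * p)" "(b + b\<^sup>2) * Y \<le> (b + b\<^sup>2) * (n * q)"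
    using b x z unfolding X_def Y_def by (intro mult_left_mono; simp)+
  ultimately show ?thesis unfolding 2 by (simp add: algebra_simps)
qed

lemma red_alert_exponent_le:
  fixes N Pavg Palert R E :: real
  assumes N: "N > 0" and Pavg: "Pavg > 0" and PP: "Palert \<ge> Pavg"
    and R: "0 \<le> R" "R < (1/2) * ln (1 + Pavg / N)"
    and ach: "achievable_exponent N Pavg Palert R E"
  shows "E \<le> (Palert + Pavg + 2 * sqrt (Palert * (Pavg + N * (1 - exp (2 * R))))) / (2 * N) - R"
    (is "E \<le> ?E")
proof (rule ccontr)
  assume "\<not> E \<le> ?E"
  define gap where "gap = E - ?E"
  have gap: "gap > 0" using \<open>\<not> E \<le> ?E\<close> by (simp add: gap_def)
  define Pm where "Pm = N * (exp (2 * R) - 1)"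
  define Pb where "Pb = Pavg - Pm"
  \<comment> \<open>This equals \<open>Pm + (sqrt Palert + sqrt Pb)\<^sup>2\<close>, the critical
    squared distance per coordinate.\<close>
  define T where "T = Palert + Pavg + 2 * sqrt (Palert * Pb)"
  have "exp (2 * R) < exp (ln (1 + Pavg / N))" using R(2) by simp
  also have "\<dots> = 1 + Pavg / N" using N Pavg by (simp add: add_pos_pos)
  finally have Pb: "Pb > 0" unfolding Pb_def Pm_def using N by (simp add: field_simps)
  have Pa: "Palert > 0" using Pavg PP by simp
  have ET: "?E = T / (2 * N) - R"
    by (simp add: T_def Pb_def Pm_def algebra_simps)
  \<comment> \<open>minimises the radius of the ball in \<open>far_codeword_in_ball\<close>\<close>
  define \<beta> where "\<beta> = sqrt (Pb / Palert)"
  have \<beta>: "\<beta> > 0" using Pb Pa by (simp add: \<beta>_def)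
  have \<beta>1: "\<beta> * sqrt (Palert * Pb) = Pb" and \<beta>2: "\<beta>\<^sup>2 * Palert = Pb"
    using Pb Pa by (simp_all add: \<beta>_def real_sqrt_mult real_sqrt_divide power_divide)
  \<comment> \<open>\<open>d2\<close> is the slack in distance, \<open>d1\<close> the excess power
    tolerated in a codeword, \<open>d3\<close> the resulting drop of the squared radius below
    \<open>Pm\<close>. A distance slack \<open>d2\<close> gains
    \<open>\<beta> * d2 = 2 * d3\<close>, of which the excess power takes back
    \<open>(1 + \<beta>) * d1 = d3\<close>.\<close>
  define d2 where "d2 = N * gap / 2"
  define d1 where "d1 = \<beta> * d2 / (2 * (1 + \<beta>))"
  define d3 where "d3 = \<beta> * d2 / 2"
  have d2: "d2 > 0" using N gap by (simp add: d2_def)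
  have d1: "d1 > 0" using \<beta> d2 by (simp add: d1_def)
  have d3: "d3 > 0" using \<beta> d2 by (simp add: d3_def)
  have d13: "(1 + \<beta>) * d1 = d3" using \<beta> by (simp add: d1_def d3_def divide_simps)
  have radius: "(1 + \<beta>) * (Pavg + d1) + (\<beta> + \<beta>\<^sup>2) * Palert - \<beta> * (T + d2) = Pm - d3"
  proof -
    have "\<beta> * T = \<beta> * Palert + \<beta> * Pavg + 2 * Pb"
      using \<beta>1 by (simp add: T_def algebra_simps)
    moreover have "\<beta> * d2 = 2 * d3" by (simp add: d3_def)
    ultimately show ?thesis using \<beta>2 d13 by (simp add: Pb_def algebra_simps)
  qed
  \<comment> \<open>By Markov's inequality at least a fraction \<open>2 * \<kappa>\<close> of the
    messages has power at most \<open>n * (Pavg + d1)\<close>. One \<open>\<kappa>\<close> is given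
    up to messages with large error.\<close>
  define \<kappa> where "\<kappa> = d1 / (2 * (Pavg + d1))"
  have \<kappa>: "\<kappa> > 0" using d1 Pavg by (simp add: \<kappa>_def)
  define \<epsilon> where "\<epsilon> = min (gap / 8) (\<kappa> / 8)"
  have \<epsilon>: "\<epsilon> > 0" "\<epsilon> \<le> gap / 8" "4 * \<epsilon> \<le> \<kappa>" using gap \<kappa> by (auto simp: \<epsilon>_def)
  obtain n0 where code: "\<forall>n\<ge>n0. \<exists>x D. valid_code Pavg Palert n (num_msgs R n) x D \<and>
    p_MD N n x D < exp (- real n * (E - \<epsilon>)) \<and> p_FA N n (num_msgs R n) x D < \<epsilon> \<and> p_MSG N n (num_msgs R n) x D < \<epsilon>"
    using ach \<epsilon>(1) unfolding achievable_exponent_def by blast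
  have gap4: "gap / 4 > 0" using gap by simp
  obtain n1 where detect: "\<forall>n\<ge>n1. \<forall>v u A. A \<in> sets (PiM {..<n} (\<lambda>_. borel)) \<longrightarrow> (\<Sum>i<n. (v i - u i)\<^sup>2) \<le> n * (T + d2) \<longrightarrow>
    measure (gauss n v (sqrt N)) A \<ge> 1/2 \<longrightarrow> measure (gauss n u (sqrt N)) A \<ge> exp (- real n * ((T + d2) / (2 * N) + gap / 4)) / 4"
    using gauss_detection_lower_bound[OF N gap4, of "T + d2"] by (elim exE)
  have "\<exists>n2. \<forall>n\<ge>n2. \<forall>m x A (W :: nat set). finite W \<longrightarrow> disjoint_family_on A W \<longrightarrow>
    (\<forall>w\<in>W. A w \<in> sets (PiM {..<n} (\<lambda>_. borel)) \<and> (\<Sum>i<n. (x w i - m i)\<^sup>2) < n * (Pm - d3) \<and>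
      measure (gauss n (x w) (sqrt N)) (A w) \<ge> 1/2) \<longrightarrow> card W \<le> \<kappa> / 4 * exp (n * R)"
  \<comment> \<open>For small \<open>R\<close> the squared radius may be nonpositive; then no
    codeword lies strictly inside. Otherwise the capacity at power \<open>Pm - d3\<close> is below
    \<open>R\<close> and the packing bound applies.\<close>
  proof (cases "Pm - d3 > 0")
    case False
    have "card W \<le> \<kappa> / 4 * exp (n * R)"
      if W: "\<forall>w\<in>W. (\<Sum>i<n. (x w i - m i)\<^sup>2) < n * (Pm - d3)"
      for n :: nat and m :: "nat \<Rightarrow> real" and x :: "nat \<Rightarrow> nat \<Rightarrow> real" and W :: "nat set"
    proof -
      have "n * (Pm - d3) \<le> 0" using False by (simp add: mult_nonneg_nonpos)
      moreover have "(\<Sum>i<n. (x w i - m i)\<^sup>2) \<ge> 0" for w by (intro sum_nonneg) simp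
      ultimately have "W = {}" using W by (meson all_not_in_conv less_le_not_le order_trans)
      then show ?thesis using \<kappa> by simp
    qed
    then show ?thesis by blast
  next
    case True
    define C where "C = ln (1 + (Pm - d3) / N) / 2"
    define g where "g = (R - C) / 2"
    have "1 + (Pm - d3) / N < exp (2 * R)" using N d3 by (simp add: Pm_def field_simps)
    then have "ln (1 + (Pm - d3) / N) < ln (exp (2 * R))"
      using True N by (subst ln_less_cancel_iff) (auto simp: add_pos_pos)
    then have g: "g > 0" by (simp add: g_def C_def)
    obtain n2 where pack: "\<forall>n\<ge>n2. \<forall>m x A (W :: nat set). finite W \<longrightarrow> disjoint_family_on A W \<longrightarrow>
      (\<forall>w\<in>W. A w \<in> sets (PiM {..<n} (\<lambda>_. borel)) \<and> (\<Sum>i<n. (x w i - m i)\<^sup>2) \<le> n * (Pm - d3) \<and>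
        measure (gauss n (x w) (sqrt N)) (A w) \<ge> 1/2) \<longrightarrow> card W \<le> 4 * exp (n * (C + g))"
      using gauss_packing_bound[OF N True g] unfolding C_def by (elim exE)
    obtain n3 where n3: "\<And>n. n \<ge> n3 \<Longrightarrow> exp (- real n * g) < \<kappa> / 16"
      using exp_decay_below[OF g, of "\<kappa> / 16"] \<kappa> by auto
    show ?thesis
    proof (intro exI[of _ "max n2 n3"] allI impI)
      fix n :: nat and m :: "nat \<Rightarrow> real" and x :: "nat \<Rightarrow> nat \<Rightarrow> real" and A and W :: "nat set"
      assume n: "max n2 n3 \<le> n" and fin: "finite W" and disj: "disjoint_family_on A W"
        and W: "\<forall>w\<in>W. A w \<in> sets (PiM {..<n} (\<lambda>_. borel)) \<and> (\<Sum>i<n. (x w i - m i)\<^sup>2) < n * (Pm - d3) \<and>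
          measure (gauss n (x w) (sqrt N)) (A w) \<ge> 1/2"
      have "card W \<le> 4 * exp (n * (C + g))"
        by (rule pack[rule_format]) (use n fin disj W in \<open>auto intro: less_imp_le\<close>)
      also have "C + g = R - g" by (simp add: g_def field_simps)
      also have "4 * exp (n * (R - g)) = 4 * exp (- real n * g) * exp (n * R)"
        by (simp add: mult_exp_exp algebra_simps)
      also have "\<dots> \<le> \<kappa> / 4 * exp (n * R)" using n3[of n] n by (intro mult_right_mono) auto
      finally show "card W \<le> \<kappa> / 4 * exp (n * R)" .
    qed
  qed
  then obtain n2 where pack: "\<forall>n\<ge>n2. \<forall>m x A (W :: nat set). finite W \<longrightarrow> disjoint_family_on A W \<longrightarrow>
    (\<forall>w\<in>W. A w \<in> sets (PiM {..<n} (\<lambda>_. borel)) \<and> (\<Sum>i<n. (x w i - m i)\<^sup>2) < n * (Pm - d3) \<and>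
      measure (gauss n (x w) (sqrt N)) (A w) \<ge> 1/2) \<longrightarrow> card W \<le> \<kappa> / 4 * exp (n * R)"
    by (elim exE)
  have gap38: "3 * gap / 8 > 0" using gap by simp
  obtain n3 where n3: "\<And>n. n \<ge> n3 \<Longrightarrow> exp (- real n * (3 * gap / 8)) < \<kappa> / 16"
    using exp_decay_below[OF gap38, of "\<kappa> / 16"] \<kappa> by auto
  \<comment> \<open>A single block length suffices for the contradiction; the entry 1 keeps
    \<open>n\<close> positive for division.\<close>
  define n where "n = Max {n0, n1, n2, n3, 1}"
  have n: "n \<ge> n0" "n \<ge> n1" "n \<ge> n2" "n \<ge> n3" "n \<ge> 1" by (auto simp: n_def)
  define M where "M = num_msgs R n"
  have M: "M > 0" "exp (n * R) / 2 \<le> real M" using num_msgs_bounds[OF R(1)] by (auto simp: M_def)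
  obtain x D where valid: "valid_code Pavg Palert n M x D" and MD: "p_MD N n x D < exp (- real n * (E - \<epsilon>))"
    and FA: "p_FA N n M x D < \<epsilon>" and MSG: "p_MSG N n M x D < \<epsilon>"
    using code[rule_format, OF n(1)] unfolding M_def by blast
  let ?B = "PiM {..<n} (\<lambda>_. borel :: real measure)"
  have D[measurable]: "D \<in> ?B \<rightarrow>\<^sub>M count_space UNIV" using valid by (simp add: valid_code_def)
  have s: "sqrt N > 0" using N by simp
  have P: "prob_space (gauss n v (sqrt N))" for v by (rule prob_space_gauss[OF s])
  have sets: "{y \<in> space ?B. S (D y)} \<in> sets (gauss n v (sqrt N))" for S v by (simp add: sets_gauss)
  note out = out_prob_eq_gauss[OF N D]
  define A where "A w = {y \<in> space ?B. D y = w}" for w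
  have A: "A w \<in> sets ?B" for w unfolding A_def by measurable
  have disj: "disjoint_family_on A S" for S by (auto simp: disjoint_family_on_def A_def)
  define err where "err w = 1 - measure (gauss n (x w) (sqrt N)) (A w)" for w
  define pow where "pow w = (\<Sum>i<n. (x w i)\<^sup>2)" for w
  have err_nonneg: "err w \<ge> 0" for w
    unfolding err_def using prob_space.prob_le_1[OF P] by simp
  \<comment> \<open>The conditional error in \<open>p_MSG\<close> dominates the joint one because
    the denominator is at most 1. If the denominator vanishes, the quotient is 0 by convention, but
    so is the numerator.\<close>
  have err_le: "err w \<le> out_prob N n x D w (\<lambda>v. v = 0) +
    out_prob N n x D w (\<lambda>v. v \<noteq> w \<and> v \<noteq> 0) / out_prob N n x D w (\<lambda>v. v \<noteq> 0)" for w
  proof -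
    interpret prob_space "gauss n (x w) (sqrt N)" by (rule P)
    have "err w = prob (space (gauss n (x w) (sqrt N)) - A w)"
      unfolding err_def using A[of w] by (intro prob_compl[symmetric]) (simp add: sets_gauss)
    also have "\<dots> \<le> prob ({y \<in> space ?B. D y = 0} \<union> {y \<in> space ?B. D y \<noteq> w \<and> D y \<noteq> 0})"
      by (intro finite_measure_mono sets.Un sets) (auto simp: A_def space_gauss)
    also have "\<dots> \<le> prob {y \<in> space ?B. D y = 0} + prob {y \<in> space ?B. D y \<noteq> w \<and> D y \<noteq> 0}"
      by (intro measure_Un_le sets)
    also have "prob {y \<in> space ?B. D y \<noteq> w \<and> D y \<noteq> 0} \<le>
      prob {y \<in> space ?B. D y \<noteq> w \<and> D y \<noteq> 0} / prob {y \<in> space ?B. D y \<noteq> 0}" (is "?a \<le> ?a / ?b")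
    proof (cases "?b = 0")
      case True
      have "?a \<le> ?b" by (intro finite_measure_mono sets) auto
      then show ?thesis using True by simp
    next
      case False
      then have "?b > 0" by (simp add: zero_less_measure_iff)
      then show ?thesis by (simp add: pos_le_divide_eq mult_left_le)
    qed
    finally show ?thesis by (simp add: out)
  qed
  have sum_err: "sum err {1..M} \<le> 2 * \<epsilon> * M"
  proof -
    have "sum err {1..M} \<le> M * p_FA N n M x D + M * p_MSG N n M x D"
      using sum_mono[of "{1..M}", OF err_le] M(1) by (simp add: p_FA_def p_MSG_def sum.distrib)
    also have "\<dots> \<le> M * \<epsilon> + M * \<epsilon>" using FA MSG by (intro add_mono mult_left_mono) auto
    finally show ?thesis by (simp add: algebra_simps)
  qed
  have sum_pow: "sum pow {1..M} \<le> M * (n * Pavg)"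
    using valid M(1) by (simp add: valid_code_def pow_def pos_divide_le_eq mult.commute)
  \<comment> \<open>The messages with both moderate power and a decoding set of probability at least
    1/2, the two properties that the packing and detection bounds need.\<close>
  define W where "W = {w\<in>{1..M}. pow w \<le> n * (Pavg + d1) \<and> err w \<le> 1/2}"
  have card_W: "card W \<ge> \<kappa> * M"
  proof -
    let ?X = "{w\<in>{1..M}. pow w > n * (Pavg + d1)}" and ?Y = "{w\<in>{1..M}. err w > 1/2}"
    have nP: "n * (Pavg + d1) > 0" using n(5) Pavg d1 by simp
    have "card ?X \<le> M * (n * Pavg) / (n * (Pavg + d1))"
      by (rule card_exceeding_le[OF _ _ nP sum_pow]) (auto simp: pow_def sum_nonneg)
    also have "\<dots> = M * (Pavg / (Pavg + d1))" using n(5) by simp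
    also have "Pavg / (Pavg + d1) = 1 - 2 * \<kappa>" using Pavg d1 by (simp add: \<kappa>_def divide_simps)
    finally have X: "card ?X \<le> M * (1 - 2 * \<kappa>)" .
    have "card ?Y \<le> (2 * \<epsilon> * M) / (1/2)"
      by (rule card_exceeding_le[OF _ _ _ sum_err]) (auto simp: err_nonneg)
    also have "\<dots> = M * (4 * \<epsilon>)" by simp
    also have "\<dots> \<le> M * \<kappa>" using \<epsilon>(3) by (intro mult_left_mono) auto
    finally have Y: "card ?Y \<le> M * \<kappa>" .
    have cover: "W \<union> ?X \<union> ?Y = {1..M}" by (auto simp: W_def)
    have "card (W \<union> ?X \<union> ?Y) = M" unfolding cover by simp
    then have "M \<le> card W + card ?X + card ?Y"
      using card_Un_le[of "W \<union> ?X" ?Y] card_Un_le[of W ?X] by linarith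
    then have "real M \<le> card W + card ?X + card ?Y" by (simp flip: of_nat_add)
    then show ?thesis using X Y by (simp add: algebra_simps)
  qed
  have W_half: "measure (gauss n (x w) (sqrt N)) (A w) \<ge> 1/2" if "w \<in> W" for w
    using that by (simp add: W_def err_def)
  have finW: "finite W" by (simp add: W_def)
  define dist2 where "dist2 w = (\<Sum>i<n. (x w i - x 0 i)\<^sup>2)" for w
  define Bad where "Bad = {w\<in>W. dist2 w > n * (T + d2)}"
  define Good where "Good = {w\<in>W. dist2 w \<le> n * (T + d2)}"
  have pow0: "(\<Sum>i<n. (x 0 i)\<^sup>2) \<le> n * Palert" using valid by (simp add: valid_code_def)
  \<comment> \<open>Far codewords are crowded into the ball around \<open>- \<beta> * x 0\<close>,
    hence few; at least half of the guaranteed \<open>\<kappa> * M\<close> messages stay in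
    \<open>Good\<close>.\<close>
  have "card Bad \<le> \<kappa> / 4 * exp (n * R)"
  proof (rule pack[rule_format, OF n(3), of Bad A x "\<lambda>i. - \<beta> * x 0 i"])
    fix w assume "w \<in> Bad"
    then have w: "w \<in> W" "dist2 w > n * (T + d2)" by (auto simp: Bad_def)
    have "(\<Sum>i<n. (x w i - - \<beta> * x 0 i)\<^sup>2) < n * (Pm - d3)"
      unfolding radius[symmetric]
      by (rule far_codeword_in_ball[OF _ pow0 \<beta>]) (use w in \<open>auto simp: W_def pow_def dist2_def\<close>)
    then show "A w \<in> sets ?B \<and> (\<Sum>i<n. (x w i - - \<beta> * x 0 i)\<^sup>2) < n * (Pm - d3) \<and>
      1/2 \<le> measure (gauss n (x w) (sqrt N)) (A w)"
      using A W_half[OF w(1)] by blast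
  qed (use finW disj in \<open>auto simp: Bad_def\<close>)
  also have "\<dots> \<le> \<kappa> / 2 * M" using M(2) \<kappa> by (simp add: mult_left_mono field_simps)
  finally have "card Bad \<le> \<kappa> / 2 * M" .
  moreover have "card W = card Good + card Bad"
  proof -
    have "W = Good \<union> Bad" "Good \<inter> Bad = {}" by (auto simp: Good_def Bad_def)
    then show ?thesis using finW by (metis card_Un_disjoint finite_Un)
  qed
  ultimately have "card Good \<ge> \<kappa> / 2 * M" using card_W by simp
  moreover have "\<kappa> / 2 * M \<ge> \<kappa> / 2 * (exp (n * R) / 2)" using M(2) \<kappa> by (intro mult_left_mono) auto
  ultimately have card_Good: "card Good \<ge> \<kappa> / 4 * exp (n * R)" by simp
  let ?q = "exp (- real n * ((T + d2) / (2 * N) + gap / 4)) / 4"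
  interpret Z: prob_space "gauss n (x 0) (sqrt N)" by (rule P)
  have "card Good * ?q = (\<Sum>w\<in>Good. ?q)" by simp
  also have "\<dots> \<le> (\<Sum>w\<in>Good. Z.prob (A w))"
  proof (intro sum_mono)
    fix w assume "w \<in> Good"
    then show "?q \<le> Z.prob (A w)"
      using A W_half[of w] by (intro detect[rule_format, OF n(2), of "A w" "x w" "x 0"])
        (auto simp: Good_def dist2_def)
  qed
  also have "\<dots> = Z.prob (\<Union>w\<in>Good. A w)"
    using finW A by (intro Z.finite_measure_finite_Union[symmetric] disj) (auto simp: Good_def sets_gauss)
  also have "\<dots> \<le> Z.prob {y \<in> space ?B. D y \<noteq> 0}"
    by (intro Z.finite_measure_mono sets) (auto simp: A_def Good_def W_def)
  also have "\<dots> = p_MD N n x D" by (simp add: p_MD_def out)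
  finally have "card Good * ?q \<le> p_MD N n x D" .
  moreover have "\<kappa> / 4 * exp (n * R) * ?q \<le> card Good * ?q" using card_Good by (intro mult_right_mono) auto
  \<comment> \<open>The slacks \<open>d2 / (2 * N)\<close> and \<open>gap / 4\<close> add up to
    \<open>gap / 2\<close>, and the number of good messages supplies the term \<open>- R\<close> of
    the exponent. Since \<open>\<epsilon>\<close> is at most \<open>gap / 8\<close>, a surplus of
    \<open>3 * gap / 8\<close> remains.\<close>
  moreover have "\<kappa> / 4 * exp (n * R) * ?q = \<kappa> / 16 * exp (- real n * (?E + gap / 2))"
  proof -
    have "(T + d2) / (2 * N) + gap / 4 = ?E + gap / 2 + R" unfolding ET using N by (simp add: d2_def field_simps)
    then show ?thesis by (simp add: mult_exp_exp algebra_simps)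
  qed
  ultimately have "\<kappa> / 16 * exp (- real n * (?E + gap / 2)) < exp (- real n * (E - \<epsilon>))" using MD by linarith
  also have "\<dots> \<le> exp (- real n * (?E + gap / 2 + 3 * gap / 8))"
  proof -
    have "?E + gap / 2 + 3 * gap / 8 \<le> E - \<epsilon>" using \<epsilon>(2) gap_def by linarith
    then show ?thesis unfolding exp_le_cancel_iff by (intro mult_left_mono_neg) simp_all
  qed
  also have "\<dots> = exp (- real n * (3 * gap / 8)) * exp (- real n * (?E + gap / 2))"
    by (simp add: mult_exp_exp algebra_simps)
  finally have "\<kappa> / 16 < exp (- real n * (3 * gap / 8))" by simp
  then show False using n3[OF n(4)] by simp
qed

theorem theorem1:
  fixes N Pavg Palert R :: real
  assumes "N > 0" and "Pavg > 0" and "Palert \<ge> Pavg"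
    and "0 \<le> R" and "R < (1/2) * ln (1 + Pavg / N)"
  shows "optimal_exponent N Pavg Palert R =
    ereal ((Palert + Pavg + 2 * sqrt (Palert * (Pavg + N * (1 - exp (2 * R))))) / (2 * N) - R)"
  unfolding optimal_exponent_def
proof (rule Sup_eqI)
  fix e assume "e \<in> {ereal E |E. achievable_exponent N Pavg Palert R E}"
  then show "e \<le> ereal ((Palert + Pavg + 2 * sqrt (Palert * (Pavg + N * (1 - exp (2 * R))))) / (2 * N) - R)"
    using red_alert_exponent_le[OF assms] by auto
next
  \<comment> \<open>The supremum is attained, since the formula is itself an achievable
    exponent.\<close>
  fix e assume "\<And>z. z \<in> {ereal E |E. achievable_exponent N Pavg Palert R E} \<Longrightarrow> z \<le> e"
  then show "ereal ((Palert + Pavg + 2 * sqrt (Palert * (Pavg + N * (1 - exp (2 * R))))) / (2 * N) - R) \<le> e"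
    using achievable_red_alert_exponent[OF assms] by blast
qed

end
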